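(* Suppose that for all $x,x_1,x_2\in\mathbb{R}^n$ and $(s,a)\in\mathcal{S}\times\mathcal{A}$: $|r_{sa}(x)|\le C_r$, $\|\nabla r_{sa}(x)\|_2\le C_{rx}$, $\|\nabla r_{sa}(x_1)-\nabla r_{sa}(x_2)\|_2\le L_r\|x_1-x_2\|_2$; and that for all trajectory tuples $\boldsymbol d=(d_1,\dots,d_I)$ and $x,x_1,x_2\in\mathbb{R}^n$: $|l(\boldsymbol d;x)|\le C_l$, $l(\boldsymbol d;\cdot)$ is continuously differentiable, $|l(\boldsymbol d;x_1)-l(\boldsymbol d;x_2)|\le L_l\|x_1-x_2\|_2$, $\|\nabla l(\boldsymbol d;x_1)-\nabla l(\boldsymbol d;x_2)\|_2\le L_{l1}\|x_1-x_2\|_2$. Given an accuracy $\epsilon$ for the SoBiRL algorithm, let the constant step size $\beta>0$ satisfy $\beta<\frac1{2L_\phi}$. Then the iterates $\{x_k\}$ satisfy $$\frac1K\sum_{k=1}^K\|\nabla\phi(x_k)\|_2^2\le\frac{\phi(x_1)-\phi^*}{K\left(\frac\beta2-\beta^2L_\phi\right)}+\frac{1+2\beta L_\phi}{1-2\beta L_\phi}L_{\widetilde\phi}^2\,\epsilon,$$ where $\phi^*$ is the minimum of $\phi$, and $$L_\phi=L_{l1}+L_lHIL_\pi\sqrt{|\mathcal{A}|}+2\tau^{-1}HI\Big(C_lL_{V1}+\frac{C_{rx}}{1-\gamma}L_l\Big)+\frac{2H^2I^2C_lC_{rx}L_\pi}{\tau(1-\gamma)}\sqrt{|\mathcal{A}|},$$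 $$L_{\widetilde\phi}=HIL_l\sqrt{|\mathcal{A}|}+\frac{2\tau^{-1}C_lC_{rx}HI\sqrt{|\mathcal{A}|}}{1-\gamma}\Big(\frac{1+\gamma}{1-\gamma}+HI\Big),$$ $$L_\pi=\frac{2\sqrt{|\mathcal{S}||\mathcal{A}|}\,C_{rx}}{\tau(1-\gamma)},\qquad L_{V1}=\frac{(1+\gamma)C_{rx}L_\pi\sqrt{|\mathcal{A}|}}{(1-\gamma)^2}+\frac{L_r}{1-\gamma}.$$
   Context: Lower level. $\mathcal{S},\mathcal{A}$ finite nonempty sets, $P_{sas'}=P(s'|s,a)$ a transition kernel, $\gamma\in(0,1)$, $\tau>0$, $r:\mathbb{R}^n\to\mathbb{R}^{|\mathcal{S}||\mathcal{A}|}$ a continuously differentiable parameterized reward. A policy is $\pi=(\pi_s)_s$ with each $\pi_s=\pi(\cdot|s)$ a probability distribution on $\mathcal{A}$, viewed in $\mathbb{R}^{|\mathcal{S}||\mathcal{A}|}$. With $h(\pi_s)=-\sum_a\pi_{sa}\log\pi_{sa}$ ($0\log0=0$), $V^\pi_s(x)=\mathbb{E}[\sum_{t\ge0}\gamma^t(r_{s_ta_t}(x)+\tau h(\pi_{s_t}))\mid s_0=s,\pi]$ (with $a_t\sim\pi(\cdot|s_t)$, $s_{t+1}\sim P(\cdot|s_t,a_t)$). For $\rho$ a distribution on $\mathcal{S}$ with positive entries, $\pi^*(x)$ is the unique maximizer over policies of $\sum_s\rho_sV^\pi_s(x)$. Upper level. $\bar P$ is a transition kernel and $\bar\rho$ an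 initial distribution on the same $\mathcal{S},\mathcal{A}$; $I,H\ge1$ integers. For a policy $\pi$, $\rho(d;\pi)$ is the distribution on $H$-step trajectories $d=\{(s_h,a_h)\}_{h=0}^{H-1}$ with $P(d;\pi)=\bar\rho(s_0)[\prod_{h=0}^{H-2}\pi(a_h|s_h)\bar P(s_{h+1}|s_h,a_h)]\pi(a_{H-1}|s_{H-1})$. The hyper-objective is $\phi(x)=f(x,\pi^*(x))$, $f(x,\pi)=\mathbb{E}[l(d_1,\dots,d_I;x)]$ with $d_1,\dots,d_I$ independent draws from $\rho(d;\pi)$; $\nabla l$ is the gradient in $x$. Estimator. For a policy $\pi$, with trajectories generated by $\pi$ and $P$, $\widetilde\nabla V_s(x,\pi)=\mathbb{E}[\sum_{t\ge0}\gamma^t\nabla r_{s_ta_t}(x)\mid s_0=s,\pi]$, $\widetilde\nabla Q_{sa}(x,\pi)=\mathbb{E}[\sum_{t\ge0}\gamma^t\nabla r_{s_ta_t}(x)\mid s_0=s,a_0=a,\pi]$, and $$\widetilde\nabla\phi(x,\pi)=\mathbb{E}_{d_i\sim\rho(d;\pi)}[\nabla l(d_1,\dots,d_I;x)]+\tau^{-1}\mathbb{E}_{d_i\sim\rho(d;\pi)}\Big[l(d_1,\dots,d_I;x)\sum_{i=1}^I\sum_{h=0}^{H-1}\big(\widetilde\nabla Q_{s_h^ia_h^i}(x,\pi)-\widetilde\nabla V_{s_h^i}(x,\pi)\big)\Big].$$ Algorithm SoBiRL (initial $x_1$, accuracy $\epsilon$, step size $\beta$): for $k=1,\dots,K$,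 obtain a policy $\pi_k$ with $\|\pi_k-\pi^*(x_k)\|_2^2\le\epsilon$ and set $x_{k+1}=x_k-\beta\widetilde\nabla\phi(x_k,\pi_k)$. *)

theory Defs
  imports "HOL-Probability.Probability"
begin

section \<open>Gradients\<close>

text \<open>Only meaningful at points where \<open>f\<close> is differentiable.\<close>

definition gradient :: "('x::real_inner \<Rightarrow> real) \<Rightarrow> 'x \<Rightarrow> 'x" where
  "gradient f x = (THE D. GDERIV f x :> D)"

definition continuously_differentiable :: "('x::real_inner \<Rightarrow> real) \<Rightarrow> bool" where
  "continuously_differentiable f \<longleftrightarrow>
     (\<exists>G. continuous_on UNIV G \<and> (\<forall>x. GDERIV f x :> G x))"

lemma gradient_eqI:
  assumes "GDERIV f x :> D"
  shows "gradient f x = D"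
  unfolding gradient_def
proof (rule the_equality)
  show "GDERIV f x :> D" by (rule assms)
next
  fix D' assume "GDERIV f x :> D'"
  with assms have "(\<lambda>h. inner h D') = (\<lambda>h. inner h D)"
    unfolding gderiv_def by (blast intro: has_derivative_unique)
  then have "inner (D' - D) (D' - D) = 0"
    by (metis inner_diff_right cancel_comm_monoid_add_class.diff_cancel)
  then show "D' = D" by simp
qed


section \<open>Policies\<close>

text \<open>A policy is a family \<open>'s \<Rightarrow> 'a pmf\<close> of distributions on the actions; the map below
  views it as a vector indexed by the state-action pairs.\<close>

definition policy_vec :: "('s::finite \<Rightarrow> 'a::finite pmf) \<Rightarrow> real ^ ('s \<times> 'a)" where
  "policy_vec \<pi> = (\<chi> sa. pmf (\<pi> (fst sa)) (snd sa))"

text \<open>\<open>ln 0 = 0\<close> in HOL, so the convention \<open>0 log 0 = 0\<close> is respected.\<close>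

definition entropy_pmf :: "'a::finite pmf \<Rightarrow> real" where
  "entropy_pmf p = - (\<Sum>a\<in>UNIV. pmf p a * ln (pmf p a))"


section \<open>Infinite trajectories of the lower-level decision process\<close>

text \<open>The state-action process \<open>(s\<^sub>0, a\<^sub>0), (s\<^sub>1, a\<^sub>1), \<dots>\<close> is a Markov chain on
  \<open>'s \<times> 'a\<close>; its law on \<open>nat \<Rightarrow> 's \<times> 'a\<close> comes from the Ionescu-Tulcea theorem.
  The parameter \<open>init\<close> is the law of \<open>(s\<^sub>0, a\<^sub>0)\<close>.\<close>

definition sa_step ::
    "('s \<Rightarrow> 'a \<Rightarrow> 's pmf) \<Rightarrow> ('s \<Rightarrow> 'a pmf) \<Rightarrow> 's \<times> 'a \<Rightarrow> ('s \<times> 'a) pmf" where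
  "sa_step P \<pi> sa =
     bind_pmf (P (fst sa) (snd sa)) (\<lambda>s'. map_pmf (\<lambda>a'. (s', a')) (\<pi> s'))"

definition sa_kernel ::
    "('s \<times> 'a) pmf \<Rightarrow> ('s \<Rightarrow> 'a \<Rightarrow> 's pmf) \<Rightarrow> ('s \<Rightarrow> 'a pmf)
       \<Rightarrow> nat \<Rightarrow> (nat \<Rightarrow> 's \<times> 'a) \<Rightarrow> ('s \<times> 'a) measure" where
  "sa_kernel init P \<pi> t \<omega> =
     measure_pmf (case t of 0 \<Rightarrow> init | Suc u \<Rightarrow> sa_step P \<pi> (\<omega> u))"

definition sa_process ::
    "('s \<times> 'a) pmf \<Rightarrow> ('s \<Rightarrow> 'a \<Rightarrow> 's pmf) \<Rightarrow> ('s \<Rightarrow> 'a pmf)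
       \<Rightarrow> (nat \<Rightarrow> 's \<times> 'a) measure" where
  "sa_process init P \<pi> =
     projective_family.lim UNIV
       (Ionescu_Tulcea.CI (sa_kernel init P \<pi>) (\<lambda>_. count_space UNIV))
       (\<lambda>_. count_space UNIV)"

lemma Ionescu_Tulcea_sa_kernel:
  fixes init :: "('s::finite \<times> 'a::finite) pmf"
  shows "Ionescu_Tulcea (sa_kernel init P \<pi>) (\<lambda>_. count_space UNIV)"
proof (rule Ionescu_Tulcea.intro)
  fix i
  show "sa_kernel init P \<pi> i
      \<in> measurable (PiM {0..<i} (\<lambda>_. count_space UNIV)) (subprob_algebra (count_space UNIV))"
  proof (cases i)
    case 0
    then show ?thesis
      unfolding sa_kernel_def by (simp add: measurable_const measure_pmf_in_subprob_algebra)
  next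
    case (Suc u)
    have "(\<lambda>\<omega>. \<omega> u) \<in> measurable (PiM {0..<i} (\<lambda>_. count_space (UNIV :: ('s \<times> 'a) set)))
        (count_space UNIV)"
      using Suc by (intro measurable_component_singleton) auto
    moreover have "(\<lambda>x. measure_pmf (sa_step P \<pi> x))
        \<in> measurable (count_space UNIV) (subprob_algebra (count_space UNIV))"
      by (simp add: measure_pmf_in_subprob_algebra)
    ultimately show ?thesis
      unfolding sa_kernel_def Suc nat.case(2) by (rule measurable_compose)
  qed
next
  show "prob_space (sa_kernel init P \<pi> i \<omega>)" for i \<omega>
    unfolding sa_kernel_def by (rule measure_pmf.prob_space_axioms)
qed

lemma
  fixes init :: "('s::finite \<times> 'a::finite) pmf"
  shows sets_sa_process [simp]:
      "sets (sa_process init P \<pi>) = sets (PiM UNIV (\<lambda>_. count_space UNIV))"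
    and prob_space_sa_process: "prob_space (sa_process init P \<pi>)"
proof -
  let ?M = "\<lambda>_::nat. count_space (UNIV :: ('s \<times> 'a) set)"
  interpret IT: Ionescu_Tulcea "sa_kernel init P \<pi>" ?M
    by (rule Ionescu_Tulcea_sa_kernel)
  show "sets (sa_process init P \<pi>) = sets (PiM UNIV ?M)"
    unfolding sa_process_def by simp
  interpret CI: prob_space "IT.CI {}"
    by (rule IT.PF.prob_space_P) auto
  have "IT.PF.emb UNIV {} (space (PiM {} ?M)) = space (PiM UNIV ?M)"
    by (auto simp: prod_emb_def space_PiM)
  moreover have "emeasure (IT.CI {}) (space (PiM {} ?M)) = 1"
    using CI.emeasure_space_1 by (simp add: IT.CI_def)
  ultimately show "prob_space (sa_process init P \<pi>)"
    unfolding sa_process_def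
    using IT.lim[of "{}" "space (PiM {} ?M)"] by (intro prob_spaceI) simp
qed

lemma emeasure_sa_process_cylinder:
  fixes init :: "('s::finite \<times> 'a::finite) pmf"
  shows "emeasure (sa_process init P \<pi>) {\<omega>. \<forall>t\<le>n. \<omega> t = z t}
    = ennreal (pmf init (z 0) * (\<Prod>t<n. pmf (sa_step P \<pi> (z t)) (z (Suc t))))"
proof -
  let ?M = "\<lambda>_::nat. count_space (UNIV :: ('s \<times> 'a) set)"
  interpret IT: Ionescu_Tulcea "sa_kernel init P \<pi>" ?M
    by (rule Ionescu_Tulcea_sa_kernel)
  have sing: "{restrict z {0..<m}} \<in> sets (PiM {0..<m} ?M)" for m
  proof -
    have "PiE {0..<m} (\<lambda>i. {z i}) = PiE {0..<m} (\<lambda>i. {restrict z {0..<m} i})"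
      by (rule PiE_cong) simp
    also have "\<dots> = {restrict z {0..<m}}"
      by (rule PiE_singleton) (rule restrict_extensional)
    finally have "PiE {0..<m} (\<lambda>i. {z i}) = {restrict z {0..<m}}" .
    moreover have "PiE {0..<m} (\<lambda>i. {z i}) \<in> sets (PiM {0..<m} ?M)"
      by (rule sets_PiM_I_finite) auto
    ultimately show ?thesis by simp
  qed
  define w where "w m = (case m of 0 \<Rightarrow> pmf init (z 0) | Suc u \<Rightarrow> pmf (sa_step P \<pi> (z u)) (z (Suc u)))" for m
  have space: "(\<lambda>_. undefined) \<in> space (PiM {0..<0} ?M)" by (simp add: space_PiM)
  have C: "emeasure (IT.C 0 m (\<lambda>_. undefined)) {restrict z {0..<m}} = ennreal (\<Prod>t<m. w t)" for m
  proof (induction m)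
    case 0
    then show ?case by (simp add: restrict_def PiM_empty)
  next
    case (Suc m)
    have eP: "emeasure (IT.eP m y) {restrict z {0..<Suc m}}
        = ennreal (w m) * indicator {restrict z {0..<m}} y"
      if y: "y \<in> space (PiM {0..<m} ?M)" for y
    proof -
      have ext: "y i = undefined" if "i \<ge> m" for i
        using y that by (auto simp: space_PiM PiE_def extensional_def)
      have *: "(\<lambda>v. y(m := v)) -` {restrict z {0..<Suc m}}
          = (if y = restrict z {0..<m} then {z m} else {})"
      proof (cases "y = restrict z {0..<m}")
        case True
        have "y(m := v) = restrict z {0..<Suc m} \<longleftrightarrow> v = z m" for v
        proof
          assume "y(m := v) = restrict z {0..<Suc m}"
          from fun_cong[OF this, of m] show "v = z m" by simp
        next
          assume "v = z m"
          with True show "y(m := v) = restrict z {0..<Suc m}"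
            by (auto simp: fun_eq_iff restrict_def)
        qed
        with True show ?thesis by auto
      next
        case False
        have "\<exists>i<m. y i \<noteq> z i"
        proof (rule ccontr)
          assume "\<not> (\<exists>i<m. y i \<noteq> z i)"
          then have "y i = restrict z {0..<m} i" for i
            using ext[of i] by (cases "i < m") simp_all
          with False show False by (simp add: fun_eq_iff)
        qed
        then obtain i where i: "i < m" "y i \<noteq> z i" by blast
        have "y(m := v) \<noteq> restrict z {0..<Suc m}" for v
        proof
          assume "y(m := v) = restrict z {0..<Suc m}"
          from fun_cong[OF this, of i] i show False by simp
        qed
        with False show ?thesis by auto
      qed
      have "emeasure (IT.eP m y) {restrict z {0..<Suc m}}
          = emeasure (sa_kernel init P \<pi> m y) (if y = restrict z {0..<m} then {z m} else {})"
        using IT.emeasure_eP[OF y sing[of "Suc m"]] by (simp add: *)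
      also have "\<dots> = ennreal (w m) * indicator {restrict z {0..<m}} y"
        by (auto simp: sa_kernel_def w_def emeasure_pmf_single restrict_def split: nat.split)
      finally show ?thesis .
    qed
    have "emeasure (IT.C 0 (Suc m) (\<lambda>_. undefined)) {restrict z {0..<Suc m}}
        = (\<integral>\<^sup>+ y. emeasure (IT.eP m y) {restrict z {0..<Suc m}} \<partial>IT.C 0 m (\<lambda>_. undefined))"
      using IT.measurable_eP[of m] sing[of "Suc m"] IT.prob_space_C[OF space, of m, THEN prob_space.not_empty]
      by (simp, subst emeasure_bind[where N="PiM {0..<Suc m} ?M"])
         (auto simp: measurable_cong_sets[OF IT.sets_C[OF space] refl])
    also have "\<dots> = (\<integral>\<^sup>+ y. ennreal (w m) * indicator {restrict z {0..<m}} y \<partial>IT.C 0 m (\<lambda>_. undefined))"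
      by (rule nn_integral_cong) (simp add: eP IT.space_C[OF space])
    also have "\<dots> = ennreal (w m) * emeasure (IT.C 0 m (\<lambda>_. undefined)) {restrict z {0..<m}}"
      by (subst nn_integral_cmult_indicator) (auto simp: IT.sets_C[OF space] sing)
    also have "\<dots> = ennreal (\<Prod>t<Suc m. w t)"
      unfolding Suc.IH
      by (subst ennreal_mult[symmetric])
         (auto simp: w_def mult.commute intro!: prod_nonneg split: nat.split)
    finally show ?case .
  qed
  have "restrict \<omega> {0..<Suc n} = restrict z {0..<Suc n} \<longleftrightarrow> (\<forall>t\<le>n. \<omega> t = z t)" for \<omega>
  proof
    assume *: "restrict \<omega> {0..<Suc n} = restrict z {0..<Suc n}"
    show "\<forall>t\<le>n. \<omega> t = z t"
    proof (intro allI impI)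
      fix t assume "t \<le> n"
      with fun_cong[OF *, of t] show "\<omega> t = z t" by simp
    qed
  next
    assume *: "\<forall>t\<le>n. \<omega> t = z t"
    then show "restrict \<omega> {0..<Suc n} = restrict z {0..<Suc n}"
      by (intro restrict_ext) simp
  qed
  then have "{\<omega>. \<forall>t\<le>n. \<omega> t = z t} = prod_emb UNIV ?M {0..<Suc n} {restrict z {0..<Suc n}}"
    by (simp add: prod_emb_def space_PiM vimage_def)
  then have "emeasure (sa_process init P \<pi>) {\<omega>. \<forall>t\<le>n. \<omega> t = z t}
      = emeasure (IT.CI {0..<Suc n}) {restrict z {0..<Suc n}}"
    unfolding sa_process_def by (simp only: IT.lim[OF finite_atLeastLessThan sing[of "Suc n"]])
  also have "\<dots> = emeasure (IT.C 0 (Suc n) (\<lambda>_. undefined))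
      (prod_emb {0..<Suc n} ?M {0..<Suc n} {restrict z {0..<Suc n}})"
    by (rule IT.emeasure_CI[OF order_refl sing[of "Suc n"]])
  also have "prod_emb {0..<Suc n} ?M {0..<Suc n} {restrict z {0..<Suc n}} = {restrict z {0..<Suc n}}"
    using sets.sets_into_space[OF sing[of "Suc n"]] by (intro prod_emb_id) (simp only: space_PiM)
  also have "emeasure (IT.C 0 (Suc n) (\<lambda>_. undefined)) {restrict z {0..<Suc n}}
      = ennreal (\<Prod>t<Suc n. w t)"
    by (rule C)
  also have "(\<Prod>t<Suc n. w t) = pmf init (z 0) * (\<Prod>t<n. pmf (sa_step P \<pi> (z t)) (z (Suc t)))"
    unfolding prod.lessThan_Suc_shift by (simp add: w_def)
  finally show ?thesis .
qed

text \<open>\<open>r\<close> is the vector of rewards at a fixed parameter value.\<close>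

definition soft_value ::
    "('s::finite \<Rightarrow> 'a::finite \<Rightarrow> 's pmf) \<Rightarrow> real \<Rightarrow> real \<Rightarrow> real ^ ('s \<times> 'a)
       \<Rightarrow> ('s \<Rightarrow> 'a pmf) \<Rightarrow> 's \<Rightarrow> real" where
  "soft_value P \<gamma> \<tau> r \<pi> s =
     (LINT \<omega>|sa_process (map_pmf (\<lambda>a. (s, a)) (\<pi> s)) P \<pi>.
        (\<Sum>t. \<gamma> ^ t * (r $ \<omega> t + \<tau> * entropy_pmf (\<pi> (fst (\<omega> t))))))"

definition optimal_policy ::
    "('s::finite \<Rightarrow> 'a::finite \<Rightarrow> 's pmf) \<Rightarrow> real \<Rightarrow> real \<Rightarrow> 's pmf \<Rightarrow> real ^ ('s \<times> 'a)
       \<Rightarrow> 's \<Rightarrow> 'a pmf" where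
  "optimal_policy P \<gamma> \<tau> \<rho> r =
     (THE \<pi>. is_arg_max (\<lambda>\<pi>'. \<Sum>s\<in>UNIV. pmf \<rho> s * soft_value P \<gamma> \<tau> r \<pi>' s) (\<lambda>_. True) \<pi>)"

definition grad_V ::
    "('s::finite \<Rightarrow> 'a::finite \<Rightarrow> 's pmf) \<Rightarrow> real \<Rightarrow> (real ^ 'n \<Rightarrow> real ^ ('s \<times> 'a))
       \<Rightarrow> real ^ 'n \<Rightarrow> ('s \<Rightarrow> 'a pmf) \<Rightarrow> 's \<Rightarrow> real ^ 'n" where
  "grad_V P \<gamma> r x \<pi> s =
     (LINT \<omega>|sa_process (map_pmf (\<lambda>a. (s, a)) (\<pi> s)) P \<pi>.
        (\<Sum>t. \<gamma> ^ t *\<^sub>R gradient (\<lambda>y. r y $ \<omega> t) x))"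

definition grad_Q ::
    "('s::finite \<Rightarrow> 'a::finite \<Rightarrow> 's pmf) \<Rightarrow> real \<Rightarrow> (real ^ 'n \<Rightarrow> real ^ ('s \<times> 'a))
       \<Rightarrow> real ^ 'n \<Rightarrow> ('s \<Rightarrow> 'a pmf) \<Rightarrow> 's \<Rightarrow> 'a \<Rightarrow> real ^ 'n" where
  "grad_Q P \<gamma> r x \<pi> s a =
     (LINT \<omega>|sa_process (return_pmf (s, a)) P \<pi>.
        (\<Sum>t. \<gamma> ^ t *\<^sub>R gradient (\<lambda>y. r y $ \<omega> t) x))"


section \<open>Finite trajectories of the upper level\<close>

text \<open>An \<open>H\<close>-step trajectory is a list of \<open>H\<close> state-action pairs, and an \<open>I\<close>-tuple of
  trajectories is a list of \<open>I\<close> such lists.\<close>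

definition traj_tuples :: "nat \<Rightarrow> nat \<Rightarrow> ('s \<times> 'a) list list set" where
  "traj_tuples I H = {ds. length ds = I \<and> (\<forall>d\<in>set ds. length d = H)}"

definition traj_prob ::
    "('s \<Rightarrow> 'a \<Rightarrow> 's pmf) \<Rightarrow> 's pmf \<Rightarrow> nat \<Rightarrow> ('s \<Rightarrow> 'a pmf) \<Rightarrow> ('s \<times> 'a) list \<Rightarrow> real" where
  "traj_prob Pb \<rho>b H \<pi> d =
     pmf \<rho>b (fst (d ! 0))
     * (\<Prod>h<H - 1. pmf (\<pi> (fst (d ! h))) (snd (d ! h))
                  * pmf (Pb (fst (d ! h)) (snd (d ! h))) (fst (d ! Suc h)))
     * pmf (\<pi> (fst (d ! (H - 1)))) (snd (d ! (H - 1)))"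

definition traj_pmf ::
    "('s \<Rightarrow> 'a \<Rightarrow> 's pmf) \<Rightarrow> 's pmf \<Rightarrow> nat \<Rightarrow> ('s \<Rightarrow> 'a pmf) \<Rightarrow> ('s \<times> 'a) list pmf" where
  "traj_pmf Pb \<rho>b H \<pi> = embed_pmf (\<lambda>d. if length d = H then traj_prob Pb \<rho>b H \<pi> d else 0)"

text \<open>\<open>embed_pmf\<close> is only meaningful for weights that sum to one. To see that this is the case
  for \<open>H \<ge> 1\<close>, the same distribution is generated step by step.\<close>

primrec path_pmf ::
    "('s \<Rightarrow> 'a \<Rightarrow> 's pmf) \<Rightarrow> ('s \<Rightarrow> 'a pmf) \<Rightarrow> nat \<Rightarrow> 's \<Rightarrow> ('s \<times> 'a) list pmf" where
  "path_pmf Pb \<pi> 0 s = map_pmf (\<lambda>a. [(s, a)]) (\<pi> s)"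
| "path_pmf Pb \<pi> (Suc n) s =
     bind_pmf (\<pi> s) (\<lambda>a. bind_pmf (Pb s a) (\<lambda>s'. map_pmf ((#) (s, a)) (path_pmf Pb \<pi> n s')))"

lemma pmf_bind_finite:
  fixes p :: "'b::finite pmf"
  shows "pmf (bind_pmf p f) y = (\<Sum>x\<in>UNIV. pmf p x * pmf (f x) y)"
  by (subst pmf_bind, subst integral_measure_pmf_real[of UNIV]) (auto simp: mult.commute)

lemma pmf_map_Cons:
  "pmf (map_pmf ((#) z) q) (z' # d) = (if z = z' then pmf q d else 0)"
proof (cases "z = z'")
  case True
  then show ?thesis
    using pmf_map_inj'[of "(#) z" q d] by (simp add: inj_on_def)
next
  case False
  then have "z' # d \<notin> set_pmf (map_pmf ((#) z) q)" by auto
  with False show ?thesis by (simp add: set_pmf_iff del: set_map_pmf)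
qed

lemma pmf_path_pmf:
  fixes Pb :: "'s::finite \<Rightarrow> 'a::finite \<Rightarrow> 's pmf"
  shows "pmf (path_pmf Pb \<pi> n s) d =
    (if length d = Suc n \<and> fst (d ! 0) = s
     then (\<Prod>h<n. pmf (\<pi> (fst (d ! h))) (snd (d ! h))
                  * pmf (Pb (fst (d ! h)) (snd (d ! h))) (fst (d ! Suc h)))
          * pmf (\<pi> (fst (d ! n))) (snd (d ! n))
     else 0)"
proof (induction n arbitrary: s d)
  case 0
  show ?case
  proof (cases "length d = Suc 0 \<and> fst (d ! 0) = s")
    case True
    then obtain a where d: "d = [(s, a)]" by (cases d) auto
    have "inj (\<lambda>a. [(s, a)])" by (simp add: inj_on_def)
    from pmf_map_inj'[OF this, of "\<pi> s" a] show ?thesis by (simp add: d)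
  next
    case False
    then have "d \<notin> set_pmf (path_pmf Pb \<pi> 0 s)" by auto
    then have "pmf (path_pmf Pb \<pi> 0 s) d = 0" by (simp only: set_pmf_iff not_not)
    with False show ?thesis by (simp only: if_False)
  qed
next
  case (Suc n)
  show ?case
  proof (cases d)
    case Nil
    then have "d \<notin> set_pmf (path_pmf Pb \<pi> (Suc n) s)" by auto
    then have "pmf (path_pmf Pb \<pi> (Suc n) s) d = 0" by (simp only: set_pmf_iff not_not)
    with Nil show ?thesis by simp
  next
    case (Cons z d')
    obtain s0 a0 where z: "z = (s0, a0)" by (cases z)
    have "pmf (path_pmf Pb \<pi> (Suc n) s) d =
      (\<Sum>a\<in>UNIV. pmf (\<pi> s) a * (\<Sum>s'\<in>UNIV. pmf (Pb s a) s'
         * (if (s, a) = (s0, a0) then pmf (path_pmf Pb \<pi> n s') d' else 0)))"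
      by (simp add: pmf_bind_finite Cons z pmf_map_Cons)
    also have "\<dots> = (\<Sum>a\<in>UNIV. if a = a0 then pmf (\<pi> s) a *
         (if s = s0 then \<Sum>s'\<in>UNIV. pmf (Pb s a) s' * pmf (path_pmf Pb \<pi> n s') d' else 0) else 0)"
      by (intro sum.cong) auto
    also have "\<dots> = (if s = s0 then pmf (\<pi> s) a0 *
         (\<Sum>s'\<in>UNIV. pmf (Pb s a0) s' * pmf (path_pmf Pb \<pi> n s') d') else 0)"
      by simp
    also have "(\<Sum>s'\<in>UNIV. pmf (Pb s a0) s' * pmf (path_pmf Pb \<pi> n s') d') =
        (\<Sum>s'\<in>UNIV. if s' = fst (d' ! 0)
           then pmf (Pb s a0) s' * pmf (path_pmf Pb \<pi> n s') d' else 0)"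
      by (intro sum.cong refl) (simp add: Suc.IH)
    also have "\<dots> = pmf (Pb s a0) (fst (d' ! 0)) * pmf (path_pmf Pb \<pi> n (fst (d' ! 0))) d'"
      by simp
    finally show ?thesis
      unfolding Suc.IH Cons z by (simp add: prod.lessThan_Suc_shift del: prod.lessThan_Suc)
  qed
qed

lemma
  fixes Pb :: "'s::finite \<Rightarrow> 'a::finite \<Rightarrow> 's pmf"
  assumes "H \<ge> 1"
  shows traj_pmf_eq: "traj_pmf Pb \<rho>b H \<pi> = bind_pmf \<rho>b (path_pmf Pb \<pi> (H - 1))"
    and pmf_traj_pmf:
      "pmf (traj_pmf Pb \<rho>b H \<pi>) d = (if length d = H then traj_prob Pb \<rho>b H \<pi> d else 0)"
proof -
  have *: "pmf (bind_pmf \<rho>b (path_pmf Pb \<pi> (H - 1))) d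
      = (if length d = H then traj_prob Pb \<rho>b H \<pi> d else 0)" for d
  proof -
    have "pmf (bind_pmf \<rho>b (path_pmf Pb \<pi> (H - 1))) d =
        (\<Sum>s\<in>UNIV. if s = fst (d ! 0) then pmf \<rho>b s * pmf (path_pmf Pb \<pi> (H - 1) s) d else 0)"
      unfolding pmf_bind_finite by (intro sum.cong refl) (simp add: pmf_path_pmf)
    also have "\<dots> = pmf \<rho>b (fst (d ! 0)) * pmf (path_pmf Pb \<pi> (H - 1) (fst (d ! 0))) d"
      by simp
    finally show ?thesis using assms by (simp add: pmf_path_pmf traj_prob_def)
  qed
  show eq: "traj_pmf Pb \<rho>b H \<pi> = bind_pmf \<rho>b (path_pmf Pb \<pi> (H - 1))"
    unfolding traj_pmf_def *[symmetric]
    by (simp add: type_definition.Rep_inverse[OF td_pmf_embed_pmf])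
  show "pmf (traj_pmf Pb \<rho>b H \<pi>) d = (if length d = H then traj_prob Pb \<rho>b H \<pi> d else 0)"
    unfolding eq by (rule *)
qed


section \<open>Hyper-objective and gradient estimator\<close>

text \<open>\<open>replicate_pmf I p\<close> is the law of a list of \<open>I\<close> independent draws from \<open>p\<close>.\<close>

definition upper_objective ::
    "('s \<Rightarrow> 'a \<Rightarrow> 's pmf) \<Rightarrow> 's pmf \<Rightarrow> nat \<Rightarrow> nat
       \<Rightarrow> (('s \<times> 'a) list list \<Rightarrow> real ^ 'n \<Rightarrow> real)
       \<Rightarrow> real ^ 'n \<Rightarrow> ('s \<Rightarrow> 'a pmf) \<Rightarrow> real" where
  "upper_objective Pb \<rho>b I H l x \<pi> =
     (LINT ds|measure_pmf (replicate_pmf I (traj_pmf Pb \<rho>b H \<pi>)). l ds x)"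

definition hyper_objective ::
    "('s::finite \<Rightarrow> 'a::finite \<Rightarrow> 's pmf) \<Rightarrow> real \<Rightarrow> real \<Rightarrow> 's pmf \<Rightarrow> (real ^ 'n \<Rightarrow> real ^ ('s \<times> 'a))
       \<Rightarrow> ('s \<Rightarrow> 'a \<Rightarrow> 's pmf) \<Rightarrow> 's pmf \<Rightarrow> nat \<Rightarrow> nat
       \<Rightarrow> (('s \<times> 'a) list list \<Rightarrow> real ^ 'n \<Rightarrow> real) \<Rightarrow> real ^ 'n \<Rightarrow> real" where
  "hyper_objective P \<gamma> \<tau> \<rho> r Pb \<rho>b I H l x =
     upper_objective Pb \<rho>b I H l x (optimal_policy P \<gamma> \<tau> \<rho> (r x))"

definition grad_estimator ::
    "('s::finite \<Rightarrow> 'a::finite \<Rightarrow> 's pmf) \<Rightarrow> real \<Rightarrow> real \<Rightarrow> (real ^ 'n \<Rightarrow> real ^ ('s \<times> 'a))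
       \<Rightarrow> ('s \<Rightarrow> 'a \<Rightarrow> 's pmf) \<Rightarrow> 's pmf \<Rightarrow> nat \<Rightarrow> nat
       \<Rightarrow> (('s \<times> 'a) list list \<Rightarrow> real ^ 'n \<Rightarrow> real)
       \<Rightarrow> real ^ 'n \<Rightarrow> ('s \<Rightarrow> 'a pmf) \<Rightarrow> real ^ 'n" where
  "grad_estimator P \<gamma> \<tau> r Pb \<rho>b I H l x \<pi> =
     (LINT ds|measure_pmf (replicate_pmf I (traj_pmf Pb \<rho>b H \<pi>)). gradient (l ds) x)
     + (1 / \<tau>) *\<^sub>R
       (LINT ds|measure_pmf (replicate_pmf I (traj_pmf Pb \<rho>b H \<pi>)).
          l ds x *\<^sub>R (\<Sum>i<I. \<Sum>h<H.
            grad_Q P \<gamma> r x \<pi> (fst (ds ! i ! h)) (snd (ds ! i ! h))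
            - grad_V P \<gamma> r x \<pi> (fst (ds ! i ! h))))"


section \<open>The algorithm\<close>

text \<open>\<open>x\<close> and \<open>\<pi>\<close> are the sequences of iterates and approximate policies of a run of \<open>K\<close>
  iterations, numbered from 1; the values at other indices are irrelevant.\<close>

definition SoBiRL ::
    "('s::finite \<Rightarrow> 'a::finite \<Rightarrow> 's pmf) \<Rightarrow> real \<Rightarrow> real \<Rightarrow> 's pmf \<Rightarrow> (real ^ 'n \<Rightarrow> real ^ ('s \<times> 'a))
       \<Rightarrow> ('s \<Rightarrow> 'a \<Rightarrow> 's pmf) \<Rightarrow> 's pmf \<Rightarrow> nat \<Rightarrow> nat
       \<Rightarrow> (('s \<times> 'a) list list \<Rightarrow> real ^ 'n \<Rightarrow> real)
       \<Rightarrow> real \<Rightarrow> real \<Rightarrow> nat \<Rightarrow> (nat \<Rightarrow> real ^ 'n) \<Rightarrow> (nat \<Rightarrow> 's \<Rightarrow> 'a pmf) \<Rightarrow> bool" where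
  "SoBiRL P \<gamma> \<tau> \<rho> r Pb \<rho>b I H l \<epsilon> \<beta> K x \<pi> \<longleftrightarrow>
     (\<forall>k\<in>{1..K}.
        (norm (policy_vec (\<pi> k) - policy_vec (optimal_policy P \<gamma> \<tau> \<rho> (r (x k)))))\<^sup>2 \<le> \<epsilon> \<and>
        x (Suc k) = x k - \<beta> *\<^sub>R grad_estimator P \<gamma> \<tau> r Pb \<rho>b I H l (x k) (\<pi> k))"

end

theory Submission
  imports Defs
begin

text \<open>The discounted expectations of the lower-level process satisfy linear Bellman equations, so
  all statements about them reduce to contraction estimates on finitely many unknowns. By the Gibbs
  variational principle the optimal policy is the softmax of the fixed point \<open>V\<^sup>*\<close> of the soft
  Bellman operator. As \<open>V\<^sup>*(r)\<close> is a maximum over policies of functions affine in \<open>r\<close>, an envelope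
  argument (rather than the implicit function theorem) shows that its derivative is the discounted
  sum of the increments of \<open>r\<close> under the optimal policy. Hence \<open>\<nabla> log \<pi>\<^sup>*\<close> is \<open>1/\<tau>\<close> times the advantage
  of \<open>\<nabla>r\<close>, and by the log-derivative trick \<open>\<nabla>\<phi>(x)\<close> is the gradient estimator at the exact policy
  \<open>\<pi>\<^sup>*(x)\<close>. Perturbation bounds in the \<open>l\<^sup>1\<close> distance of the policies make \<open>\<nabla>\<phi>\<close> Lipschitz with
  constant \<open>L\<^sub>\<phi>\<close> and bound the error of the estimator, and the rate is the standard analysis of
  gradient descent with an inexact gradient.\<close>

section \<open>Expectations under finitely supported distributions\<close>

text \<open>The constants are prescribed, which dictates the choice of norms. Policies are compared
  state by state in \<open>l1_dist\<close>: an expectation of a quantity bounded by \<open>C\<close>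
  moves by at most \<open>l1_dist p q * C\<close>, and the distance is subadditive over successive
  draws, so \<open>I\<close> trajectories of \<open>H\<close> actions cost a factor
  \<open>H * I\<close>. The Euclidean norm enters only at the end: Cauchy-Schwarz over the actions
  of one state gives each \<open>sqrt CARD('a)\<close>, and an entrywise gradient bound gives the
  root in \<open>L_\<pi>\<close>. One estimate, \<open>estimator_diff_le\<close>, in which parameter
  and policy both vary, yields both constants: equal parameters give \<open>L_\<phi>t\<close>, the
  optimal policies at two parameters give \<open>L_\<phi>\<close>. It is sharper than required,
  since the stated constants count the policy part of the advantage perturbation twice.
  Differentiability is a bootstrap: the two-sided envelope bound first gives Lipschitz continuity of
  \<open>opt_V\<close>, hence continuity of the softmax policy, and this makes the two sides agree
  to first order.\<close>

lemma expectation_eq_sum: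
  fixes f :: "'a \<Rightarrow> 'e::{banach,second_countable_topology}"
  assumes "finite A" "set_pmf p \<subseteq> A"
  shows "measure_pmf.expectation p f = (\<Sum>x\<in>A. pmf p x *\<^sub>R f x)"
  using assms by (intro integral_measure_pmf) auto

lemma expectation_eq_sum_UNIV:
  fixes f :: "'a::finite \<Rightarrow> 'e::{banach,second_countable_topology}"
  shows "measure_pmf.expectation p f = (\<Sum>x\<in>UNIV. pmf p x *\<^sub>R f x)"
  by (rule expectation_eq_sum) auto

lemma norm_expectation_le:
  fixes f :: "'a \<Rightarrow> 'e::{banach,second_countable_topology}"
  assumes fin: "finite (set_pmf p)" and bound: "\<And>x. x \<in> set_pmf p \<Longrightarrow> norm (f x) \<le> C"
  shows "norm (measure_pmf.expectation p f) \<le> C"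
proof -
  have "norm (measure_pmf.expectation p f) \<le> (\<Sum>x\<in>set_pmf p. norm (pmf p x *\<^sub>R f x))"
    unfolding expectation_eq_sum[OF fin order_refl] by (rule norm_sum)
  also have "\<dots> \<le> (\<Sum>x\<in>set_pmf p. pmf p x * C)"
    by (intro sum_mono) (auto intro!: mult_left_mono bound)
  also have "\<dots> = C"
    using fin by (simp add: sum_distrib_right[symmetric] sum_pmf_eq_1)
  finally show ?thesis .
qed

lemma expectation_le:
  fixes f :: "'a::finite \<Rightarrow> real"
  assumes "\<And>x. f x \<le> C"
  shows "measure_pmf.expectation p f \<le> C"
proof -
  have "measure_pmf.expectation p f \<le> (\<Sum>x\<in>UNIV. pmf p x * C)"
    unfolding expectation_eq_sum_UNIV by (auto intro!: sum_mono mult_left_mono assms)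
  also have "\<dots> = C"
    by (simp add: sum_distrib_right[symmetric] sum_pmf_eq_1)
  finally show ?thesis .
qed

lemma expectation_bind_pmf:
  fixes g :: "'b \<Rightarrow> 'e::{banach,second_countable_topology}"
  assumes "finite (set_pmf p)" and "\<And>x. x \<in> set_pmf p \<Longrightarrow> finite (set_pmf (f x))"
  shows "measure_pmf.expectation (bind_pmf p f) g
    = measure_pmf.expectation p (\<lambda>x. measure_pmf.expectation (f x) g)"
proof -
  let ?B = "set_pmf (bind_pmf p f)"
  have fin: "finite ?B" using assms by auto
  have "measure_pmf.expectation (bind_pmf p f) g = (\<Sum>y\<in>?B. pmf (bind_pmf p f) y *\<^sub>R g y)"
    by (rule expectation_eq_sum[OF fin order_refl])
  also have "\<dots> = (\<Sum>y\<in>?B. \<Sum>x\<in>set_pmf p. pmf p x *\<^sub>R pmf (f x) y *\<^sub>R g y)"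
    by (simp only: pmf_bind expectation_eq_sum[OF assms(1) order_refl] scaleR_sum_left real_scaleR_def scaleR_scaleR)
  also have "\<dots> = (\<Sum>x\<in>set_pmf p. pmf p x *\<^sub>R (\<Sum>y\<in>?B. pmf (f x) y *\<^sub>R g y))"
    unfolding scaleR_sum_right by (rule sum.swap)
  also have "\<dots> = (\<Sum>x\<in>set_pmf p. pmf p x *\<^sub>R measure_pmf.expectation (f x) g)"
    by (intro sum.cong refl arg_cong2[where f=scaleR] expectation_eq_sum[symmetric] fin) auto
  also have "\<dots> = measure_pmf.expectation p (\<lambda>x. measure_pmf.expectation (f x) g)"
    by (rule expectation_eq_sum[OF assms(1) order_refl, symmetric])
  finally show ?thesis .
qed

text \<open>Twice the total variation distance. Summing over the supports only keeps the sum finite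
  for finitely supported laws on infinite types such as lists of trajectories.\<close>

definition l1_dist :: "'a pmf \<Rightarrow> 'a pmf \<Rightarrow> real" where
  "l1_dist p q = (\<Sum>x\<in>set_pmf p \<union> set_pmf q. \<bar>pmf p x - pmf q x\<bar>)"

lemma l1_dist_eq_sum:
  assumes "finite A" "set_pmf p \<subseteq> A" "set_pmf q \<subseteq> A"
  shows "l1_dist p q = (\<Sum>x\<in>A. \<bar>pmf p x - pmf q x\<bar>)"
  unfolding l1_dist_def using assms by (intro sum.mono_neutral_left) (auto simp: set_pmf_iff)

lemma l1_dist_UNIV:
  fixes p q :: "'a::finite pmf"
  shows "l1_dist p q = (\<Sum>a\<in>UNIV. \<bar>pmf p a - pmf q a\<bar>)"
  by (rule l1_dist_eq_sum) auto

lemma l1_dist_nonneg [simp]: "0 \<le> l1_dist p q"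
  unfolding l1_dist_def by (intro sum_nonneg) auto

lemma l1_dist_self [simp]: "l1_dist p p = 0"
  unfolding l1_dist_def by simp

text \<open>Splits \<open>p f - q g\<close> as \<open>(p - q) f + q (f - g)\<close>, so a change of
  law and a change of integrand are charged separately. This is the source of every later
  perturbation bound.\<close>

lemma norm_expectation_diff_le:
  fixes f g :: "'a \<Rightarrow> 'e::{banach,second_countable_topology}"
  assumes fin: "finite (set_pmf p)" "finite (set_pmf q)"
    and f: "\<And>x. x \<in> set_pmf p \<union> set_pmf q \<Longrightarrow> norm (f x) \<le> C"
    and fg: "\<And>x. x \<in> set_pmf q \<Longrightarrow> norm (f x - g x) \<le> D"
  shows "norm (measure_pmf.expectation p f - measure_pmf.expectation q g)
    \<le> l1_dist p q * C + D"
proof -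
  let ?A = "set_pmf p \<union> set_pmf q"
  have A: "finite ?A" using fin by auto
  have "measure_pmf.expectation p f - measure_pmf.expectation q g
    = (\<Sum>x\<in>?A. (pmf p x - pmf q x) *\<^sub>R f x + pmf q x *\<^sub>R (f x - g x))"
    using A by (simp add: expectation_eq_sum[of ?A] sum_subtractf[symmetric] algebra_simps)
  also have "norm \<dots> \<le> (\<Sum>x\<in>?A. \<bar>pmf p x - pmf q x\<bar> * C + pmf q x * D)"
  proof (intro sum_norm_le)
    fix x assume x: "x \<in> ?A"
    have "norm (pmf q x *\<^sub>R (f x - g x)) \<le> pmf q x * D"
      by (cases "x \<in> set_pmf q") (auto intro!: mult_left_mono fg simp: set_pmf_iff)
    moreover have "norm ((pmf p x - pmf q x) *\<^sub>R f x) \<le> \<bar>pmf p x - pmf q x\<bar> * C"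
      using f[OF x] by (simp add: mult_left_mono)
    ultimately show "norm ((pmf p x - pmf q x) *\<^sub>R f x + pmf q x *\<^sub>R (f x - g x))
        \<le> \<bar>pmf p x - pmf q x\<bar> * C + pmf q x * D"
      by (rule norm_triangle_mono[rotated])
  qed
  also have "\<dots> = l1_dist p q * C + D"
    using A by (simp add: sum.distrib sum_distrib_right[symmetric] l1_dist_def sum_pmf_eq_1)
  finally show ?thesis .
qed

text \<open>The same splitting, applied to the kernels: \<open>(p - q) f + q (f - g)\<close>, where
  each \<open>f x\<close> has total mass one. Each further random draw thus adds its own worst-case
  distance, which is where the factors \<open>H\<close> and \<open>I\<close> originate.\<close>

lemma l1_dist_bind_le:
  assumes fin: "finite (set_pmf p)" "finite (set_pmf q)"
    and fin': "\<And>x. x \<in> set_pmf p \<union> set_pmf q \<Longrightarrow> finite (set_pmf (f x))"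
      "\<And>x. x \<in> set_pmf p \<union> set_pmf q \<Longrightarrow> finite (set_pmf (g x))"
    and le: "\<And>x. x \<in> set_pmf p \<union> set_pmf q \<Longrightarrow> l1_dist (f x) (g x) \<le> D"
  shows "l1_dist (bind_pmf p f) (bind_pmf q g) \<le> l1_dist p q + D"
proof -
  let ?A = "set_pmf p \<union> set_pmf q"
  let ?B = "\<Union>x\<in>?A. set_pmf (f x) \<union> set_pmf (g x)"
  have A: "finite ?A" using fin by auto
  have B: "finite ?B" using A fin' by auto
  have bnd: "\<bar>(\<Sum>x\<in>?A. pmf p x * pmf (f x) y) - (\<Sum>x\<in>?A. pmf q x * pmf (g x) y)\<bar>
      \<le> (\<Sum>x\<in>?A. \<bar>pmf p x - pmf q x\<bar> * pmf (f x) y + pmf q x * \<bar>pmf (f x) y - pmf (g x) y\<bar>)" for y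
  proof -
    have "(\<Sum>x\<in>?A. pmf p x * pmf (f x) y) - (\<Sum>x\<in>?A. pmf q x * pmf (g x) y)
      = (\<Sum>x\<in>?A. (pmf p x - pmf q x) * pmf (f x) y + pmf q x * (pmf (f x) y - pmf (g x) y))"
      by (simp add: sum_subtractf[symmetric] algebra_simps)
    also have "\<bar>\<dots>\<bar> \<le> (\<Sum>x\<in>?A. \<bar>(pmf p x - pmf q x) * pmf (f x) y + pmf q x * (pmf (f x) y - pmf (g x) y)\<bar>)"
      by (rule sum_abs)
    also have "\<dots> \<le> (\<Sum>x\<in>?A. \<bar>pmf p x - pmf q x\<bar> * pmf (f x) y + pmf q x * \<bar>pmf (f x) y - pmf (g x) y\<bar>)"
      by (intro sum_mono order_trans[OF abs_triangle_ineq]) (simp add: abs_mult)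
    finally show ?thesis .
  qed
  have "l1_dist (bind_pmf p f) (bind_pmf q g)
      = (\<Sum>y\<in>?B. \<bar>pmf (bind_pmf p f) y - pmf (bind_pmf q g) y\<bar>)"
    by (rule l1_dist_eq_sum[OF B]) auto
  also have "\<dots> = (\<Sum>y\<in>?B. \<bar>(\<Sum>x\<in>?A. pmf p x * pmf (f x) y) - (\<Sum>x\<in>?A. pmf q x * pmf (g x) y)\<bar>)"
    using A by (simp add: pmf_bind expectation_eq_sum[of ?A])
  also have "\<dots> \<le> (\<Sum>y\<in>?B. \<Sum>x\<in>?A. \<bar>pmf p x - pmf q x\<bar> * pmf (f x) y + pmf q x * \<bar>pmf (f x) y - pmf (g x) y\<bar>)"
    by (intro sum_mono bnd)
  also have "\<dots> = (\<Sum>x\<in>?A. \<bar>pmf p x - pmf q x\<bar> * (\<Sum>y\<in>?B. pmf (f x) y)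
      + pmf q x * (\<Sum>y\<in>?B. \<bar>pmf (f x) y - pmf (g x) y\<bar>))"
    by (subst sum.swap) (simp add: sum.distrib sum_distrib_left)
  also have "\<dots> \<le> (\<Sum>x\<in>?A. \<bar>pmf p x - pmf q x\<bar> * 1 + pmf q x * D)"
  proof (intro sum_mono add_mono mult_left_mono)
    fix x assume x: "x \<in> ?A"
    show "(\<Sum>y\<in>?B. pmf (f x) y) \<le> 1"
      using x B by (subst sum_pmf_eq_1) auto
    have "(\<Sum>y\<in>?B. \<bar>pmf (f x) y - pmf (g x) y\<bar>) = l1_dist (f x) (g x)"
      using x by (intro l1_dist_eq_sum[symmetric] B) auto
    then show "(\<Sum>y\<in>?B. \<bar>pmf (f x) y - pmf (g x) y\<bar>) \<le> D"
      using le[OF x] by simp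
  qed auto
  also have "\<dots> = l1_dist p q + D"
    using A by (simp add: sum.distrib sum_distrib_right[symmetric] l1_dist_def sum_pmf_eq_1)
  finally show ?thesis .
qed

lemma l1_dist_map_le:
  assumes "finite (set_pmf p)" "finite (set_pmf q)"
  shows "l1_dist (map_pmf f p) (map_pmf f q) \<le> l1_dist p q"
  using l1_dist_bind_le[of p q "\<lambda>x. return_pmf (f x)" "\<lambda>x. return_pmf (f x)" 0] assms
  by (simp add: map_pmf_def)

lemma finite_set_replicate_pmf:
  assumes "finite (set_pmf p)"
  shows "finite (set_pmf (replicate_pmf n p))"
  using assms by (induction n) auto

lemma l1_dist_replicate_le:
  assumes fin: "finite (set_pmf p)" "finite (set_pmf q)"
  shows "l1_dist (replicate_pmf n p) (replicate_pmf n q) \<le> real n * l1_dist p q"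
proof (induction n)
  case 0
  then show ?case by simp
next
  case (Suc n)
  have "l1_dist (replicate_pmf (Suc n) p) (replicate_pmf (Suc n) q)
      \<le> l1_dist p q + (l1_dist (replicate_pmf n p) (replicate_pmf n q) + 0)"
    unfolding replicate_pmf.simps
    by (intro l1_dist_bind_le) (auto simp: fin finite_set_replicate_pmf)
  with Suc show ?case by (simp add: algebra_simps)
qed

lemma pmf_replicate_pmf:
  assumes "finite (set_pmf p)"
  shows "pmf (replicate_pmf n p) xs = (if length xs = n then \<Prod>i<n. pmf p (xs ! i) else 0)"
proof (induction n arbitrary: xs)
  case 0
  then show ?case by (simp add: pmf_return)
next
  case (Suc n)
  have *: "replicate_pmf (Suc n) p = bind_pmf p (\<lambda>x. map_pmf ((#) x) (replicate_pmf n p))"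
    by (simp add: map_pmf_def)
  show ?case
  proof (cases xs)
    case Nil
    then have "xs \<notin> set_pmf (replicate_pmf (Suc n) p)" by auto
    with Nil show ?thesis by (simp only: set_pmf_iff) simp
  next
    case (Cons y ys)
    have "pmf (replicate_pmf (Suc n) p) xs
        = (\<Sum>x\<in>insert y (set_pmf p). pmf p x * (if x = y then pmf (replicate_pmf n p) ys else 0))"
      unfolding * pmf_bind Cons pmf_map_Cons
      using assms by (subst expectation_eq_sum[of "insert y (set_pmf p)"]) auto
    also have "\<dots> = (\<Sum>x\<in>insert y (set_pmf p). if x = y then pmf p x * pmf (replicate_pmf n p) ys else 0)"
      by (intro sum.cong) auto
    also have "\<dots> = pmf p y * pmf (replicate_pmf n p) ys"
      using assms by simp
    finally show ?thesis
      by (simp add: Suc Cons prod.lessThan_Suc_shift del: prod.lessThan_Suc)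
  qed
qed

section \<open>Discounted sums along a Markov chain\<close>

text \<open>The maximum of \<open>u\<close> is attained on a finite type, so the step may be applied
  with \<open>M\<close> equal to it. The values may have any sign, so the lemma serves norms as well
  as one-sided comparisons.\<close>

lemma contraction_bound:
  fixes u :: "'b::finite \<Rightarrow> real"
  assumes "\<gamma> < 1" and step: "\<And>z M. (\<And>w. u w \<le> M) \<Longrightarrow> u z \<le> c + \<gamma> * M"
  shows "u z \<le> c / (1 - \<gamma>)"
proof -
  define M where "M = Max (range u)"
  have le: "u w \<le> M" for w unfolding M_def by (rule Max_ge) auto
  have "M \<in> range u" unfolding M_def by (rule Max_in) auto
  then have "M \<le> c + \<gamma> * M" using step[OF le] by auto
  then have "M \<le> c / (1 - \<gamma>)" using assms(1) by (simp add: field_simps)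
  with le[of z] show ?thesis by simp
qed

definition kernel_op ::
    "('b \<Rightarrow> 'b pmf) \<Rightarrow> ('b \<Rightarrow> 'e::{banach,second_countable_topology}) \<Rightarrow> 'b \<Rightarrow> 'e" where
  "kernel_op K g w = measure_pmf.expectation (K w) g"

text \<open>The Neumann series of the resolvent of the Markov operator \<open>kernel_op K\<close>,
  that is, the solution \<open>g\<close> of \<open>g = f + \<gamma> K g\<close>.\<close>

definition discounted ::
    "real \<Rightarrow> ('b \<Rightarrow> 'b pmf) \<Rightarrow> ('b \<Rightarrow> 'e::{banach,second_countable_topology}) \<Rightarrow> 'b \<Rightarrow> 'e" where
  "discounted \<gamma> K f z = (\<Sum>t. \<gamma> ^ t *\<^sub>R (kernel_op K ^^ t) f z)"

lemma norm_kernel_op_power_le: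
  fixes f :: "'b::finite \<Rightarrow> 'e::{banach,second_countable_topology}"
  assumes "\<And>z. norm (f z) \<le> C"
  shows "norm ((kernel_op K ^^ t) f z) \<le> C"
  by (induction t arbitrary: z) (auto simp: assms kernel_op_def intro!: norm_expectation_le)

lemma finite_fun_bounded:
  fixes f :: "'b::finite \<Rightarrow> 'e::real_normed_vector"
  obtains C where "\<And>z. norm (f z) \<le> C"
proof
  show "norm (f z) \<le> Max (range (\<lambda>z. norm (f z)))" for z
    by (rule Max_ge) auto
qed

lemma summable_discounted:
  fixes f :: "'b::finite \<Rightarrow> 'e::{banach,second_countable_topology}"
  assumes "0 \<le> \<gamma>" "\<gamma> < 1"
  shows "summable (\<lambda>t. \<gamma> ^ t *\<^sub>R (kernel_op K ^^ t) f z)"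
proof -
  obtain C where C: "\<And>z. norm (f z) \<le> C" using finite_fun_bounded[of f] by blast
  show ?thesis
  proof (rule summable_comparison_test')
    show "summable (\<lambda>t. \<gamma> ^ t * C)"
      using assms by (intro summable_mult2 summable_geometric) auto
    show "norm (\<gamma> ^ t *\<^sub>R (kernel_op K ^^ t) f z) \<le> \<gamma> ^ t * C" if "t \<ge> 0" for t
      using assms norm_kernel_op_power_le[where f=f and C=C, OF C] by (simp add: mult_left_mono)
  qed
qed

lemma discounted_Bellman:
  fixes f :: "'b::finite \<Rightarrow> 'e::{banach,second_countable_topology}"
  assumes "0 \<le> \<gamma>" "\<gamma> < 1"
  shows "discounted \<gamma> K f z = f z + \<gamma> *\<^sub>R measure_pmf.expectation (K z) (discounted \<gamma> K f)"
proof -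
  note sm = summable_discounted[OF assms, of K f]
  have "discounted \<gamma> K f z = f z + (\<Sum>t. \<gamma> ^ Suc t *\<^sub>R (kernel_op K ^^ Suc t) f z)"
    unfolding discounted_def using suminf_split_head[OF sm[of z]] by simp
  also have "(\<Sum>t. \<gamma> ^ Suc t *\<^sub>R (kernel_op K ^^ Suc t) f z)
      = (\<Sum>t. \<gamma> *\<^sub>R (\<Sum>w\<in>UNIV. pmf (K z) w *\<^sub>R \<gamma> ^ t *\<^sub>R (kernel_op K ^^ t) f w))"
    by (simp add: kernel_op_def[of K "(kernel_op K ^^ _) f"] expectation_eq_sum_UNIV
        scaleR_sum_right mult_ac)
  also have "\<dots> = \<gamma> *\<^sub>R (\<Sum>t. \<Sum>w\<in>UNIV. pmf (K z) w *\<^sub>R \<gamma> ^ t *\<^sub>R (kernel_op K ^^ t) f w)"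
    by (intro suminf_scaleR_right[symmetric] summable_sum summable_scaleR_right sm)
  also have "(\<Sum>t. \<Sum>w\<in>UNIV. pmf (K z) w *\<^sub>R \<gamma> ^ t *\<^sub>R (kernel_op K ^^ t) f w)
      = (\<Sum>w\<in>UNIV. pmf (K z) w *\<^sub>R discounted \<gamma> K f w)"
    unfolding discounted_def suminf_scaleR_right[OF sm]
    by (intro suminf_sum summable_scaleR_right sm)
  also have "(\<Sum>w\<in>UNIV. pmf (K z) w *\<^sub>R discounted \<gamma> K f w)
      = measure_pmf.expectation (K z) (discounted \<gamma> K f)"
    by (rule expectation_eq_sum_UNIV[symmetric])
  finally show ?thesis .
qed

section \<open>Time marginals of the path measure\<close>

lemma sa_process_cylinder_meas:
  "{\<omega>. \<forall>t\<le>n. \<omega> t = z t} \<in> sets (PiM UNIV (\<lambda>_::nat. count_space (UNIV :: 'b set)))"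
proof -
  let ?M = "PiM UNIV (\<lambda>_::nat. count_space (UNIV :: 'b set))"
  have "{\<omega> \<in> space ?M. \<forall>t\<in>{..n}. \<omega> t = z t} \<in> sets ?M"
    by measurable
  moreover have "{\<omega> \<in> space ?M. \<forall>t\<in>{..n}. \<omega> t = z t} = {\<omega>. \<forall>t\<le>n. \<omega> t = z t}"
    by (auto simp: space_PiM)
  ultimately show ?thesis by simp
qed

lemma expectation_sa_process:
  fixes f :: "'s::finite \<times> 'a::finite \<Rightarrow> 'e::{banach,second_countable_topology}"
  shows "(LINT \<omega>|sa_process init P \<pi>. f (\<omega> t))
    = measure_pmf.expectation init ((kernel_op (sa_step P \<pi>) ^^ t) f)"
proof -
  let ?M = "sa_process init P \<pi>"
  let ?N = "PiM UNIV (\<lambda>_::nat. count_space (UNIV :: ('s \<times> 'a) set))"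
  interpret prob_space ?M by (rule prob_space_sa_process)
  have space: "space ?M = UNIV"
    using sets_eq_imp_space_eq[OF sets_sa_process] by (simp add: space_PiM)
  have cyl_meas: "{\<omega>. \<forall>t\<le>n. \<omega> t = z t} \<in> events" for n z
    unfolding sets_sa_process by (rule sa_process_cylinder_meas)
  have coord: "(\<lambda>\<omega>. \<omega> t) \<in> measurable ?M (count_space UNIV)" for t
    unfolding measurable_cong_sets[OF sets_sa_process refl] by measurable
  have ev: "{\<omega>. \<omega> t = c} \<in> events" for t c
    using measurable_sets[OF coord[of t], of "{c}"] by (simp add: space vimage_def)
  have cyl: "prob {\<omega>. \<forall>t\<le>n. \<omega> t = z t}
      = pmf init (z 0) * (\<Prod>t<n. pmf (sa_step P \<pi> (z t)) (z (Suc t)))" for n z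
    unfolding measure_def emeasure_sa_process_cylinder
    by (intro enn2real_ennreal mult_nonneg_nonneg prod_nonneg) auto
  \<comment> \<open>The histories up to time \<open>n\<close>, as extensional functions: two
    distinct ones differ at some \<open>t \<le> n\<close>, so their cylinders are disjoint and
    partition the path space.\<close>
  let ?Z = "\<lambda>n::nat. PiE {..n} (\<lambda>_. UNIV :: ('s \<times> 'a) set)"
  have finZ: "finite (?Z n)" for n by (rule finite_PiE) auto
  have marg: "prob {\<omega>. \<omega> (Suc n) = c'} = (\<Sum>c\<in>UNIV. prob {\<omega>. \<omega> n = c} * pmf (sa_step P \<pi> c) c')"
    for n c'
  proof -
    have disj: "disjoint_family_on (\<lambda>z. {\<omega>. \<forall>t\<le>n. \<omega> t = z t}) (?Z n)" for n
    proof (unfold disjoint_family_on_def, intro ballI impI)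
      fix y z assume yz: "y \<in> ?Z n" "z \<in> ?Z n" "y \<noteq> z"
      then obtain t where "t \<le> n" "y t \<noteq> z t"
        using PiE_ext[OF yz(1,2)] by auto
      then show "{\<omega>. \<forall>t\<le>n. \<omega> t = y t} \<inter> {\<omega>. \<forall>t\<le>n. \<omega> t = z t} = {}" by auto
    qed
    have split: "prob {\<omega>. \<omega> n = c} = (\<Sum>z\<in>?Z n. if z n = c then prob {\<omega>. \<forall>t\<le>n. \<omega> t = z t} else 0)" for c
    proof -
      have eq: "{\<omega>. \<omega> n = c} = (\<Union>z\<in>{z \<in> ?Z n. z n = c}. {\<omega>. \<forall>t\<le>n. \<omega> t = z t})"
      proof (intro set_eqI iffI)
        fix \<omega> assume "\<omega> \<in> {\<omega>. \<omega> n = c}"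
        then show "\<omega> \<in> (\<Union>z\<in>{z \<in> ?Z n. z n = c}. {\<omega>. \<forall>t\<le>n. \<omega> t = z t})"
          by (intro UN_I[of "restrict \<omega> {..n}"]) auto
      qed auto
      have "prob {\<omega>. \<omega> n = c} = (\<Sum>z\<in>{z \<in> ?Z n. z n = c}. prob {\<omega>. \<forall>t\<le>n. \<omega> t = z t})"
        unfolding eq using finZ[of n] disj[of n]
        by (intro finite_measure_finite_Union)
           (auto simp: disjoint_family_on_def sa_process_cylinder_meas)
      then show ?thesis using finZ[of n] by (simp add: sum.inter_filter)
    qed
    \<comment> \<open>The event at time \<open>Suc n\<close> is cut along the histories up to
      \<open>n\<close>, each prolonged by \<open>c'\<close>. The probability of such a cylinder is
      that of the shorter one times a single transition, and grouping by the last state gives the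
      Markov recursion.\<close>
    have eq: "{\<omega>. \<omega> (Suc n) = c'} = (\<Union>z\<in>?Z n. {\<omega>. \<forall>t\<le>Suc n. \<omega> t = (z(Suc n := c')) t})"
    proof (intro set_eqI iffI)
      fix \<omega> assume "\<omega> \<in> {\<omega>. \<omega> (Suc n) = c'}"
      then show "\<omega> \<in> (\<Union>z\<in>?Z n. {\<omega>. \<forall>t\<le>Suc n. \<omega> t = (z(Suc n := c')) t})"
        by (intro UN_I[of "restrict \<omega> {..n}"]) auto
    qed auto
    have "prob {\<omega>. \<omega> (Suc n) = c'}
        = (\<Sum>z\<in>?Z n. prob {\<omega>. \<forall>t\<le>Suc n. \<omega> t = (z(Suc n := c')) t})"
      unfolding eq
    proof (intro finite_measure_finite_Union finZ)
      show "disjoint_family_on (\<lambda>z. {\<omega>. \<forall>t\<le>Suc n. \<omega> t = (z(Suc n := c')) t}) (?Z n)"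
      proof (unfold disjoint_family_on_def, intro ballI impI)
        fix y z assume yz: "y \<in> ?Z n" "z \<in> ?Z n" "y \<noteq> z"
        then obtain t where "t \<le> n" "y t \<noteq> z t"
          using PiE_ext[OF yz(1,2)] by auto
        then have "t \<le> Suc n" "t \<noteq> Suc n" by auto
        with \<open>y t \<noteq> z t\<close> show "{\<omega>. \<forall>t\<le>Suc n. \<omega> t = (y(Suc n := c')) t}
            \<inter> {\<omega>. \<forall>t\<le>Suc n. \<omega> t = (z(Suc n := c')) t} = {}"
          by (auto simp del: fun_upd_apply) (metis fun_upd_other)
      qed
    qed (use cyl_meas in blast)
    also have "\<dots> = (\<Sum>z\<in>?Z n. prob {\<omega>. \<forall>t\<le>n. \<omega> t = z t} * pmf (sa_step P \<pi> (z n)) c')"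
      unfolding cyl by (intro sum.cong refl) simp
    also have "\<dots> = (\<Sum>z\<in>?Z n. \<Sum>c\<in>UNIV. if z n = c then
        prob {\<omega>. \<forall>t\<le>n. \<omega> t = z t} * pmf (sa_step P \<pi> c) c' else 0)"
      by simp
    also have "\<dots> = (\<Sum>c\<in>UNIV. prob {\<omega>. \<omega> n = c} * pmf (sa_step P \<pi> c) c')"
      unfolding split sum_distrib_right by (subst sum.swap) (intro sum.cong refl, auto)
    finally show ?thesis .
  qed
  have fin_sum: "(LINT \<omega>|?M. f (\<omega> t)) = (\<Sum>c\<in>UNIV. prob {\<omega>. \<omega> t = c} *\<^sub>R f c)"
    for t and f :: "'s \<times> 'a \<Rightarrow> 'e"
  proof -
    have "f (\<omega> t) = (\<Sum>c\<in>UNIV. indicator {\<omega>. \<omega> t = c} \<omega> *\<^sub>R f c)" for \<omega>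
    proof -
      have "(\<Sum>c\<in>UNIV. indicator {\<omega>. \<omega> t = c} \<omega> *\<^sub>R f c) = (\<Sum>c\<in>UNIV. if \<omega> t = c then f c else 0)"
        by (intro sum.cong) (auto simp: indicator_def)
      then show ?thesis by simp
    qed
    then have "(LINT \<omega>|?M. f (\<omega> t)) = (LINT \<omega>|?M. (\<Sum>c\<in>UNIV. indicator {\<omega>. \<omega> t = c} \<omega> *\<^sub>R f c))"
      by simp
    also have "\<dots> = (\<Sum>c\<in>UNIV. LINT \<omega>|?M. indicator {\<omega>. \<omega> t = c} \<omega> *\<^sub>R f c)"
      using ev by (intro Bochner_Integration.integral_sum integrable_scaleR_left)
        (auto simp: emeasure_eq_measure)
    also have "\<dots> = (\<Sum>c\<in>UNIV. prob {\<omega>. \<omega> t = c} *\<^sub>R f c)"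
      using ev by (intro sum.cong refl) (simp add: space emeasure_eq_measure)
    finally show ?thesis .
  qed
  \<comment> \<open>The integrand is kept general in the induction: one step back in time replaces
    \<open>f\<close> by its image under the Markov operator.\<close>
  show ?thesis
  proof (induction t arbitrary: f)
    case 0
    have "prob {\<omega>. \<omega> 0 = c} = pmf init c" for c
      using cyl[of 0 "\<lambda>_. c"] by simp
    then show ?case by (simp add: fin_sum expectation_eq_sum_UNIV)
  next
    case (Suc t)
    have "(LINT \<omega>|?M. f (\<omega> (Suc t)))
        = (\<Sum>c'\<in>UNIV. \<Sum>c\<in>UNIV. (prob {\<omega>. \<omega> t = c} * pmf (sa_step P \<pi> c) c') *\<^sub>R f c')"
      by (simp only: fin_sum marg scaleR_sum_left)
    also have "\<dots> = (\<Sum>c\<in>UNIV. prob {\<omega>. \<omega> t = c} *\<^sub>R kernel_op (sa_step P \<pi>) f c)"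
      unfolding kernel_op_def expectation_eq_sum_UNIV
      by (subst sum.swap) (simp add: scaleR_sum_right)
    also have "\<dots> = (LINT \<omega>|?M. kernel_op (sa_step P \<pi>) f (\<omega> t))"
      by (rule fin_sum[symmetric])
    finally show ?case
      unfolding Suc by (simp add: funpow_swap1)
  qed
qed

text \<open>The bridge from the path measure to algebra: geometric domination lets series and
  integral be exchanged. All three lower-level expectations, \<open>soft_value\<close>,
  \<open>grad_V\<close> and \<open>grad_Q\<close>, pass through it.\<close>

lemma integral_sa_process:
  fixes f :: "'s::finite \<times> 'a::finite \<Rightarrow> 'e::{banach,second_countable_topology}"
  assumes \<gamma>: "0 \<le> \<gamma>" "\<gamma> < 1"
  shows "(LINT \<omega>|sa_process init P \<pi>. (\<Sum>t. \<gamma> ^ t *\<^sub>R f (\<omega> t)))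
    = measure_pmf.expectation init (discounted \<gamma> (sa_step P \<pi>) f)"
proof -
  let ?M = "sa_process init P \<pi>"
  let ?K = "kernel_op (sa_step P \<pi>)"
  interpret prob_space ?M by (rule prob_space_sa_process)
  obtain C where C: "\<And>z. norm (f z) \<le> C" using finite_fun_bounded[of f] by blast
  have coord: "(\<lambda>\<omega>. \<omega> t) \<in> measurable ?M (count_space UNIV)" for t
    unfolding measurable_cong_sets[OF sets_sa_process refl] by measurable
  have meas: "(\<lambda>\<omega>. \<gamma> ^ t *\<^sub>R f (\<omega> t)) \<in> borel_measurable ?M" for t
    by (rule measurable_compose[OF coord]) simp
  have bound: "norm (\<gamma> ^ t *\<^sub>R f z) \<le> \<gamma> ^ t * C" for t z
    using \<gamma> C[of z] by (simp add: mult_left_mono)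
  have int: "integrable ?M (\<lambda>\<omega>. \<gamma> ^ t *\<^sub>R f (\<omega> t))" for t
    by (rule integrable_const_bound[OF _ meas, where B="\<gamma> ^ t * C"]) (simp add: bound del: norm_scaleR)
  have geo: "summable (\<lambda>t. \<gamma> ^ t * C)"
    using \<gamma> by (intro summable_mult2 summable_geometric) auto
  have "(LINT \<omega>|?M. (\<Sum>t. \<gamma> ^ t *\<^sub>R f (\<omega> t))) = (\<Sum>t. LINT \<omega>|?M. \<gamma> ^ t *\<^sub>R f (\<omega> t))"
  proof (rule integral_suminf[OF int])
    show "AE \<omega> in ?M. summable (\<lambda>t. norm (\<gamma> ^ t *\<^sub>R f (\<omega> t)))"
      by (intro AE_I2 summable_comparison_test'[OF geo, where N=0]) (simp add: bound del: norm_scaleR)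
    show "summable (\<lambda>t. LINT \<omega>|?M. norm (\<gamma> ^ t *\<^sub>R f (\<omega> t)))"
    proof (rule summable_comparison_test'[OF geo, where N=0])
      fix t
      have "(LINT \<omega>|?M. norm (\<gamma> ^ t *\<^sub>R f (\<omega> t))) \<le> (LINT \<omega>|?M. \<gamma> ^ t * C)"
        by (intro integral_mono integrable_norm int integrable_const bound)
      then show "norm (LINT \<omega>|?M. norm (\<gamma> ^ t *\<^sub>R f (\<omega> t))) \<le> \<gamma> ^ t * C"
        by (simp add: prob_space del: norm_scaleR)
    qed
  qed
  also have "\<dots> = (\<Sum>t. \<Sum>z\<in>UNIV. pmf init z *\<^sub>R \<gamma> ^ t *\<^sub>R (?K ^^ t) f z)"
    by (simp add: expectation_sa_process expectation_eq_sum_UNIV scaleR_sum_right mult_ac)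
  also have "\<dots> = measure_pmf.expectation init (discounted \<gamma> (sa_step P \<pi>) f)"
    unfolding expectation_eq_sum_UNIV discounted_def suminf_scaleR_right[OF summable_discounted[OF \<gamma>]]
    by (intro suminf_sum summable_scaleR_right summable_discounted \<gamma>)
  finally show ?thesis .
qed

lemma expectation_diff:
  fixes f g :: "'b::finite \<Rightarrow> 'e::{banach,second_countable_topology}"
  shows "measure_pmf.expectation p (\<lambda>x. f x - g x)
    = measure_pmf.expectation p f - measure_pmf.expectation p g"
  by (simp add: expectation_eq_sum_UNIV sum_subtractf scaleR_diff_right)

lemma expectation_add:
  fixes f g :: "'b::finite \<Rightarrow> 'e::{banach,second_countable_topology}"
  shows "measure_pmf.expectation p (\<lambda>x. f x + g x)
    = measure_pmf.expectation p f + measure_pmf.expectation p g"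
  by (simp add: expectation_eq_sum_UNIV sum.distrib scaleR_add_right)

lemma expectation_linear:
  fixes f :: "'b::finite \<Rightarrow> 'e::{banach,second_countable_topology}"
    and T :: "'e \<Rightarrow> 'd::{banach,second_countable_topology}"
  assumes "linear T"
  shows "measure_pmf.expectation p (\<lambda>x. T (f x)) = T (measure_pmf.expectation p f)"
  using assms by (simp add: expectation_eq_sum_UNIV linear_sum linear_scale)

section \<open>Linear Bellman equations\<close>

locale discounted_mdp =
  fixes P :: "'s::finite \<Rightarrow> 'a::finite \<Rightarrow> 's pmf" and \<gamma> :: real
  assumes gamma: "0 < \<gamma>" "\<gamma> < 1"
begin

text \<open>The running quantity is Banach-valued because it is later instantiated both with real
  rewards plus entropy and with the gradient vectors of the reward.\<close>

definition Qval ::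
    "('s \<Rightarrow> 'a pmf) \<Rightarrow> ('s \<times> 'a \<Rightarrow> 'e::{banach,second_countable_topology}) \<Rightarrow> 's \<Rightarrow> 'a \<Rightarrow> 'e" where
  "Qval \<pi> f s a = discounted \<gamma> (sa_step P \<pi>) f (s, a)"

definition Vval ::
    "('s \<Rightarrow> 'a pmf) \<Rightarrow> ('s \<times> 'a \<Rightarrow> 'e::{banach,second_countable_topology}) \<Rightarrow> 's \<Rightarrow> 'e" where
  "Vval \<pi> f s = measure_pmf.expectation (\<pi> s) (Qval \<pi> f s)"

lemma Qval_Bellman:
  "Qval \<pi> f s a = f (s, a) + \<gamma> *\<^sub>R measure_pmf.expectation (P s a) (Vval \<pi> f)"
proof -
  have "Qval \<pi> f s a = f (s, a) + \<gamma> *\<^sub>R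
      measure_pmf.expectation (sa_step P \<pi> (s, a)) (discounted \<gamma> (sa_step P \<pi>) f)"
    unfolding Qval_def using gamma by (intro discounted_Bellman) auto
  also have "measure_pmf.expectation (sa_step P \<pi> (s, a)) (discounted \<gamma> (sa_step P \<pi>) f)
      = measure_pmf.expectation (P s a) (Vval \<pi> f)"
    by (simp add: sa_step_def expectation_bind_pmf Vval_def[abs_def] Qval_def[abs_def])
  finally show ?thesis .
qed

lemma Vval_Bellman:
  "Vval \<pi> f s = measure_pmf.expectation (\<pi> s)
    (\<lambda>a. f (s, a) + \<gamma> *\<^sub>R measure_pmf.expectation (P s a) (Vval \<pi> f))"
  by (subst Vval_def) (simp only: Qval_Bellman[abs_def])

text \<open>The difference of two solutions satisfies the homogeneous equation, hence is contracted
  to zero. Identities for \<open>Vval\<close> (linearity, additivity, the value of the softmax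
  policy) are then proved by checking the Bellman equation instead of manipulating series.\<close>

lemma Vval_unique:
  assumes "\<And>s. V s = measure_pmf.expectation (\<pi> s)
    (\<lambda>a. f (s, a) + \<gamma> *\<^sub>R measure_pmf.expectation (P s a) V)"
  shows "V s = Vval \<pi> f s"
proof -
  have "norm (V s - Vval \<pi> f s) \<le> 0 / (1 - \<gamma>)"
  proof (rule contraction_bound[OF gamma(2)])
    fix s M assume M: "\<And>s. norm (V s - Vval \<pi> f s) \<le> M"
    have "V s - Vval \<pi> f s = measure_pmf.expectation (\<pi> s)
        (\<lambda>a. \<gamma> *\<^sub>R measure_pmf.expectation (P s a) (\<lambda>s'. V s' - Vval \<pi> f s'))"
      by (subst assms, subst Vval_Bellman)
         (simp add: expectation_diff[symmetric] scaleR_diff_right[symmetric] del: integral_scaleR_right)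
    also have "norm \<dots> \<le> \<gamma> * M"
      using gamma by (auto intro!: norm_expectation_le mult_left_mono M simp del: integral_scaleR_right)
    finally show "norm (V s - Vval \<pi> f s) \<le> 0 + \<gamma> * M" by simp
  qed
  then show ?thesis by simp
qed

lemma norm_Qval_le:
  assumes "\<And>z. norm (f z) \<le> C"
  shows "norm (Qval \<pi> f s a) \<le> C / (1 - \<gamma>)"
proof -
  have "norm (case z of (s, a) \<Rightarrow> Qval \<pi> f s a) \<le> C / (1 - \<gamma>)" for z
  proof (rule contraction_bound[OF gamma(2)])
    fix z :: "'s \<times> 'a" and M assume M: "\<And>z. norm (case z of (s, a) \<Rightarrow> Qval \<pi> f s a) \<le> M"
    obtain s a where z: "z = (s, a)" by (cases z)
    have "norm (Vval \<pi> f s) \<le> M" for s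
      unfolding Vval_def using M[of "(s, _)"] by (intro norm_expectation_le) auto
    then have "norm (measure_pmf.expectation (P s a) (Vval \<pi> f)) \<le> M"
      by (intro norm_expectation_le) auto
    then show "norm (case z of (s, a) \<Rightarrow> Qval \<pi> f s a) \<le> C + \<gamma> * M"
      using gamma assms[of "(s, a)"] unfolding z prod.case Qval_Bellman
      by (intro norm_triangle_mono) (auto intro!: mult_left_mono)
  qed
  from this[of "(s, a)"] show ?thesis by simp
qed

lemma norm_Vval_le:
  assumes "\<And>z. norm (f z) \<le> C"
  shows "norm (Vval \<pi> f s) \<le> C / (1 - \<gamma>)"
  unfolding Vval_def by (intro norm_expectation_le norm_Qval_le assms) auto

lemma Vval_linear:
  fixes f :: "'s \<times> 'a \<Rightarrow> 'e::{banach,second_countable_topology}"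
    and T :: "'e \<Rightarrow> 'd::{banach,second_countable_topology}"
  assumes T: "linear T"
  shows "Vval \<pi> (\<lambda>z. T (f z)) s = T (Vval \<pi> f s)"
proof (rule Vval_unique[symmetric])
  fix s
  have "T (Vval \<pi> f s) = T (measure_pmf.expectation (\<pi> s)
    (\<lambda>a. f (s, a) + \<gamma> *\<^sub>R measure_pmf.expectation (P s a) (Vval \<pi> f)))"
    by (subst Vval_Bellman) simp
  then show "T (Vval \<pi> f s) = measure_pmf.expectation (\<pi> s)
      (\<lambda>a. T (f (s, a)) + \<gamma> *\<^sub>R measure_pmf.expectation (P s a) (\<lambda>s. T (Vval \<pi> f s)))"
    by (simp add: expectation_linear[OF T, symmetric] linear_add[OF T] linear_scale[OF T]
        del: integral_scaleR_right)
qed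

lemma Vval_add: "Vval \<pi> (\<lambda>z. f z + g z) s = Vval \<pi> f s + Vval \<pi> g s"
proof (rule Vval_unique[symmetric])
  show "Vval \<pi> f s + Vval \<pi> g s = measure_pmf.expectation (\<pi> s)
      (\<lambda>a. f (s, a) + g (s, a) + \<gamma> *\<^sub>R measure_pmf.expectation (P s a) (\<lambda>s. Vval \<pi> f s + Vval \<pi> g s))" for s
    by (subst Vval_Bellman[of \<pi> f s], subst Vval_Bellman[of \<pi> g s])
       (simp only: expectation_add scaleR_add_right add_ac)
qed

lemma Vval_diff: "Vval \<pi> (\<lambda>z. f z - g z) s = Vval \<pi> f s - Vval \<pi> g s"
  using Vval_add[of \<pi> "\<lambda>z. f z - g z" g s] by simp

lemma bounded_linear_Vval: "bounded_linear (\<lambda>h::real ^ ('s \<times> 'a). Vval \<pi> (\<lambda>z. h $ z) s)"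
proof -
  have "linear (\<lambda>h::real ^ ('s \<times> 'a). Vval \<pi> (\<lambda>z. h $ z) s)"
  proof (rule linearI)
    fix c :: real and h :: "real ^ ('s \<times> 'a)"
    have "linear (\<lambda>y::real. c * y)" by (rule linear_times)
    from Vval_linear[OF this, of \<pi> "\<lambda>z. h $ z" s]
    show "Vval \<pi> (\<lambda>z. (c *\<^sub>R h) $ z) s = c *\<^sub>R Vval \<pi> (\<lambda>z. h $ z) s" by simp
  qed (simp add: Vval_add)
  then show ?thesis by (simp add: linear_conv_bounded_linear)
qed

lemma Qval_diff_le:
  assumes "norm (f (s, a) - g (s, a)) \<le> \<eta>"
    and "\<And>s. norm (Vval \<pi>\<^sub>1 f s - Vval \<pi>\<^sub>2 g s) \<le> M"
  shows "norm (Qval \<pi>\<^sub>1 f s a - Qval \<pi>\<^sub>2 g s a) \<le> \<eta> + \<gamma> * M"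
proof -
  have "Qval \<pi>\<^sub>1 f s a - Qval \<pi>\<^sub>2 g s a = (f (s, a) - g (s, a)) + \<gamma> *\<^sub>R
      measure_pmf.expectation (P s a) (\<lambda>s'. Vval \<pi>\<^sub>1 f s' - Vval \<pi>\<^sub>2 g s')"
    by (simp add: Qval_Bellman expectation_diff algebra_simps)
  also have "norm \<dots> \<le> \<eta> + \<gamma> * M"
  proof (rule norm_triangle_mono[OF assms(1)])
    have "norm (measure_pmf.expectation (P s a) (\<lambda>s'. Vval \<pi>\<^sub>1 f s' - Vval \<pi>\<^sub>2 g s')) \<le> M"
      by (intro norm_expectation_le assms(2)) auto
    then show "norm (\<gamma> *\<^sub>R measure_pmf.expectation (P s a) (\<lambda>s'. Vval \<pi>\<^sub>1 f s' - Vval \<pi>\<^sub>2 g s')) \<le> \<gamma> * M"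
      using gamma by simp
  qed
  finally show ?thesis .
qed

text \<open>One Bellman step charges the change of the action law against the bound
  \<open>C / (1 - \<gamma>)\<close> on \<open>Qval\<close>, plus \<open>\<eta>\<close> for the
  change of \<open>f\<close>; everything else is discounted by \<open>\<gamma>\<close>. Solving the
  resulting recursion yields the second factor \<open>1 / (1 - \<gamma>)\<close>.\<close>

lemma Vval_perturb:
  assumes f: "\<And>z. norm (f z) \<le> C" and fg: "\<And>z. norm (f z - g z) \<le> \<eta>"
    and \<delta>: "\<And>s. l1_dist (\<pi>\<^sub>1 s) (\<pi>\<^sub>2 s) \<le> \<delta>"
  shows "norm (Vval \<pi>\<^sub>1 f s - Vval \<pi>\<^sub>2 g s) \<le> (\<eta> + \<delta> * C / (1 - \<gamma>)) / (1 - \<gamma>)"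
proof (rule contraction_bound[OF gamma(2)])
  fix s M assume M: "\<And>s. norm (Vval \<pi>\<^sub>1 f s - Vval \<pi>\<^sub>2 g s) \<le> M"
  have C: "0 \<le> C" using f norm_ge_zero order_trans by blast
  have "norm (Vval \<pi>\<^sub>1 f s - Vval \<pi>\<^sub>2 g s)
      \<le> l1_dist (\<pi>\<^sub>1 s) (\<pi>\<^sub>2 s) * (C / (1 - \<gamma>)) + (\<eta> + \<gamma> * M)"
    unfolding Vval_def[of _ _ s]
    by (intro norm_expectation_diff_le norm_Qval_le Qval_diff_le f fg M) auto
  also have "l1_dist (\<pi>\<^sub>1 s) (\<pi>\<^sub>2 s) * (C / (1 - \<gamma>)) \<le> \<delta> * (C / (1 - \<gamma>))"
    using C gamma by (intro mult_right_mono \<delta>) auto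
  finally show "norm (Vval \<pi>\<^sub>1 f s - Vval \<pi>\<^sub>2 g s) \<le> (\<eta> + \<delta> * C / (1 - \<gamma>)) + \<gamma> * M"
    by simp
qed

lemma grad_V_eq_Vval:
  "grad_V P \<gamma> r x \<pi> s = Vval \<pi> (\<lambda>z. gradient (\<lambda>y. r y $ z) x) s"
  unfolding grad_V_def Vval_def Qval_def
  using gamma by (subst integral_sa_process) auto

lemma grad_Q_eq_Qval:
  "grad_Q P \<gamma> r x \<pi> s a = Qval \<pi> (\<lambda>z. gradient (\<lambda>y. r y $ z) x) s a"
  unfolding grad_Q_def Qval_def
  using gamma by (subst integral_sa_process) auto

end

section \<open>Entropy regularization\<close>

text \<open>The tangent inequality \<open>ln t \<le> t - 1\<close> at \<open>t = q / p\<close>, with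
  its equality case \<open>t = 1\<close>. The value \<open>p = 0\<close> is treated apart because an
  action may have probability zero.\<close>

lemma mult_ln_diff_le:
  fixes p q :: real
  assumes "0 \<le> p" "0 < q"
  shows "p * (ln q - ln p) \<le> q - p" and "p * (ln q - ln p) = q - p \<Longrightarrow> p = q"
proof -
  have "p * (ln q - ln p) \<le> q - p \<and> (p * (ln q - ln p) = q - p \<longrightarrow> p = q)"
  proof (cases "p = 0")
    case False
    with assms have p: "0 < p" by simp
    then have ln: "ln q - ln p = ln (q / p)" using assms by (simp add: ln_div)
    have 0: "0 < q / p" using p assms by simp
    have "p * ln (q / p) \<le> p * (q / p - 1)"
      using ln_le_minus_one[OF 0] p by (intro mult_left_mono) auto
    moreover have eq: "p * (q / p - 1) = q - p" using p by (simp add: field_simps)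
    moreover have "p = q" if "p * ln (q / p) = q - p"
    proof -
      from that have "p * ln (q / p) = p * (q / p - 1)" by (simp only: eq)
      then have "ln (q / p) = q / p - 1" using p by simp
      from ln_eq_minus_one[OF 0 this] show ?thesis using p by simp
    qed
    ultimately show ?thesis by (simp add: ln)
  qed (use assms in auto)
  then show "p * (ln q - ln p) \<le> q - p" and "p * (ln q - ln p) = q - p \<Longrightarrow> p = q" by auto
qed

lemma sum_softmax:
  fixes Q :: "'a::finite \<Rightarrow> real"
  assumes "\<tau> > 0"
  shows "(\<Sum>a\<in>UNIV. exp ((Q a - \<tau> * ln (\<Sum>a\<in>UNIV. exp (Q a / \<tau>))) / \<tau>)) = 1"
proof -
  define Z where "Z = (\<Sum>a\<in>UNIV. exp (Q a / \<tau>))"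
  have Z: "Z > 0" unfolding Z_def by (intro sum_pos) auto
  have "exp ((Q a - \<tau> * ln Z) / \<tau>) = exp (Q a / \<tau>) / Z" for a
    using assms Z by (simp add: diff_divide_distrib exp_diff)
  then show ?thesis
    using Z unfolding Z_def[symmetric] by (simp add: sum_divide_distrib[symmetric] Z_def[symmetric])
qed

lemma gibbs_variational:
  fixes Q :: "'a::finite \<Rightarrow> real"
  assumes \<tau>: "\<tau> > 0"
    and v: "v = \<tau> * ln (\<Sum>a\<in>UNIV. exp (Q a / \<tau>))"
  shows gibbs_le: "measure_pmf.expectation p Q + \<tau> * entropy_pmf p \<le> v" (is "?E \<le> v")
    and gibbs_eq_iff: "measure_pmf.expectation p Q + \<tau> * entropy_pmf p = v
      \<longleftrightarrow> (\<forall>a. pmf p a = exp ((Q a - v) / \<tau>))"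
proof -
  define q where "q a = exp ((Q a - v) / \<tau>)" for a
  have q_pos: "q a > 0" for a by (simp add: q_def)
  have Q: "Q a = v + \<tau> * ln (q a)" for a using \<tau> by (simp add: q_def)
  have q1: "(\<Sum>a\<in>UNIV. q a) = 1" unfolding q_def v by (rule sum_softmax[OF \<tau>])
  have p1: "(\<Sum>a\<in>UNIV. pmf p a) = 1" by (rule sum_pmf_eq_1) auto
  define gap where "gap a = q a - pmf p a - pmf p a * (ln (q a) - ln (pmf p a))" for a
  have gap0: "gap a \<ge> 0" for a
    using mult_ln_diff_le(1)[of "pmf p a" "q a"] q_pos by (simp add: gap_def)
  have "?E = v * (\<Sum>a\<in>UNIV. pmf p a) + \<tau> * (\<Sum>a\<in>UNIV. pmf p a * (ln (q a) - ln (pmf p a)))"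
    unfolding expectation_eq_sum_UNIV entropy_pmf_def
    by (simp add: Q sum.distrib sum_distrib_left sum_subtractf algebra_simps)
  moreover have "(\<Sum>a\<in>UNIV. gap a) = - (\<Sum>a\<in>UNIV. pmf p a * (ln (q a) - ln (pmf p a)))"
    unfolding gap_def by (simp add: sum_subtractf q1 p1)
  ultimately have E: "?E = v - \<tau> * (\<Sum>a\<in>UNIV. gap a)" by (simp add: p1)
  have "(\<Sum>a\<in>UNIV. gap a) \<ge> 0" by (intro sum_nonneg gap0)
  with \<tau> show "?E \<le> v" unfolding E by simp
  have "?E = v \<longleftrightarrow> (\<Sum>a\<in>UNIV. gap a) = 0" unfolding E using \<tau> by simp
  also have "\<dots> \<longleftrightarrow> (\<forall>a. gap a = 0)" using gap0 by (subst sum_nonneg_eq_0_iff) auto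
  also have "\<dots> \<longleftrightarrow> (\<forall>a. pmf p a = q a)"
    using mult_ln_diff_le(2)[of "pmf p _" "q _"] q_pos by (auto simp: gap_def)
  finally show "?E = v \<longleftrightarrow> (\<forall>a. pmf p a = exp ((Q a - v) / \<tau>))" by (simp add: q_def)
qed

lemma pmf_embed_finite:
  fixes q :: "'a::finite \<Rightarrow> real"
  assumes "\<And>a. 0 \<le> q a" "(\<Sum>a\<in>UNIV. q a) = 1"
  shows "pmf (embed_pmf q) a = q a"
  using assms by (intro pmf_embed_pmf) (auto simp: nn_integral_count_space_finite sum_ennreal)

section \<open>The soft Bellman equation and the optimal policy\<close>

locale soft_mdp = discounted_mdp P \<gamma>
  for P :: "'s::finite \<Rightarrow> 'a::finite \<Rightarrow> 's pmf" and \<gamma> :: real +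
  fixes \<tau> :: real
  assumes tau: "\<tau> > 0"
begin

text \<open>Brouwer's theorem on a box that the soft Bellman operator maps into itself; continuity
  and an a priori bound are all that has to be checked.\<close>

lemma ex_soft_Bellman:
  fixes r :: "real ^ ('s \<times> 'a)"
  shows "\<exists>V::real ^ 's. \<forall>s. V $ s
    = \<tau> * ln (\<Sum>a\<in>UNIV. exp ((r $ (s, a) + \<gamma> * measure_pmf.expectation (P s a) (\<lambda>s'. V $ s')) / \<tau>))"
proof -
  define q where "q V s a = r $ (s, a) + \<gamma> * measure_pmf.expectation (P s a) (\<lambda>s'. V $ s')"
    for V :: "real ^ 's" and s a
  define T :: "real ^ 's \<Rightarrow> real ^ 's" where
    "T V = (\<chi> s. \<tau> * ln (\<Sum>a\<in>UNIV. exp (q V s a / \<tau>)))" for V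
  define N where "N = real CARD('a)"
  have N: "N \<ge> 1" unfolding N_def by (simp add: Suc_leI)
  \<comment> \<open>The solution of \<open>B = norm r + \<tau> * ln N + \<gamma> * B\<close>: on
    values bounded by \<open>B\<close>, the soft maximum is at most the largest action value plus
    \<open>\<tau> * ln N\<close>, so the operator preserves this bound.\<close>
  define B where "B = (norm r + \<tau> * ln N) / (1 - \<gamma>)"
  have lnN: "\<tau> * ln N \<ge> 0" using N tau by simp
  have B: "B = norm r + \<tau> * ln N + \<gamma> * B"
    using gamma by (simp add: B_def field_simps)
  have B0: "B \<ge> 0" unfolding B_def using gamma lnN by simp
  let ?S = "cbox (\<chi> s. - B) (\<chi> s. B) :: (real ^ 's) set"
  have pos: "(\<Sum>a\<in>UNIV. exp (q V s a / \<tau>)) > 0" for V s by (intro sum_pos) auto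
  have cont: "continuous_on ?S T"
    unfolding T_def q_def expectation_eq_sum_UNIV
    by (intro continuous_intros) (use pos tau in \<open>auto simp: q_def expectation_eq_sum_UNIV less_imp_neq[symmetric]\<close>)
  have into: "T \<in> ?S \<rightarrow> ?S"
  proof
    fix V assume "V \<in> ?S"
    then have V: "\<bar>V $ s\<bar> \<le> B" for s by (auto simp: mem_box_cart abs_le_iff) (metis minus_le_iff)
    have q: "\<bar>q V s a\<bar> \<le> norm r + \<gamma> * B" for s a
    proof -
      have "norm (measure_pmf.expectation (P s a) (\<lambda>s'. V $ s')) \<le> B"
        by (rule norm_expectation_le) (auto simp: V)
      then have "norm (\<gamma> * measure_pmf.expectation (P s a) (\<lambda>s'. V $ s')) \<le> \<gamma> * B"
        using gamma by (simp add: abs_mult)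
      moreover have "norm (r $ (s, a)) \<le> norm r" by (rule Finite_Cartesian_Product.norm_nth_le)
      ultimately show ?thesis unfolding q_def real_norm_def[symmetric] by (intro norm_triangle_mono)
    qed
    have up: "T V $ s \<le> B" for s
    proof -
      have "(\<Sum>a\<in>UNIV. exp (q V s a / \<tau>)) \<le> (\<Sum>a\<in>(UNIV::'a set). exp ((norm r + \<gamma> * B) / \<tau>))"
        using q[of s] tau by (intro sum_mono) (auto simp: divide_right_mono abs_le_iff)
      then have "ln (\<Sum>a\<in>UNIV. exp (q V s a / \<tau>)) \<le> ln (N * exp ((norm r + \<gamma> * B) / \<tau>))"
        using pos by (simp add: N_def)
      also have "\<dots> = ln N + (norm r + \<gamma> * B) / \<tau>" using N by (simp add: ln_mult)
      finally have "T V $ s \<le> \<tau> * (ln N + (norm r + \<gamma> * B) / \<tau>)"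
        using tau by (simp add: T_def)
      also have "\<dots> = \<tau> * ln N + (norm r + \<gamma> * B)" using tau by (simp add: field_simps)
      finally show ?thesis using B by simp
    qed
    have lo: "- B \<le> T V $ s" for s
    proof -
      \<comment> \<open>Any single action bounds the sum of exponentials from below.\<close>
      let ?a = "undefined :: 'a"
      have "exp (- (norm r + \<gamma> * B) / \<tau>) \<le> exp (q V s ?a / \<tau>)"
        using q[of s ?a] tau by (simp add: divide_right_mono abs_le_iff)
      also have "\<dots> \<le> (\<Sum>a\<in>UNIV. exp (q V s a / \<tau>))" by (rule member_le_sum) auto
      finally have "- (norm r + \<gamma> * B) / \<tau> \<le> ln (\<Sum>a\<in>UNIV. exp (q V s a / \<tau>))"
        using pos[of V s] by (simp add: ln_ge_iff)
      then have "- (norm r + \<gamma> * B) \<le> T V $ s"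
        using tau by (simp add: T_def field_simps)
      then show ?thesis using B lnN by linarith
    qed
    show "T V \<in> ?S" using up lo by (simp add: mem_box_cart)
  qed
  have ne: "?S \<noteq> {}"
  proof -
    have "0 \<in> ?S" using B0 by (simp add: mem_box_cart)
    then show ?thesis by blast
  qed
  obtain V where V: "T V = V"
    by (rule brouwer[OF compact_cbox convex_box(1) ne cont into])
  have "V $ s = \<tau> * ln (\<Sum>a\<in>UNIV. exp (q V s a / \<tau>))" for s
    by (subst V[symmetric]) (simp add: T_def)
  then show ?thesis unfolding q_def by blast
qed

text \<open>The choice of fixed point is immaterial: \<open>soft_value_le_opt_V\<close> and
  \<open>soft_value_opt_pi\<close> identify it with the maximum of \<open>soft_value\<close> over
  all policies. It is chosen as a vector since Brouwer's theorem lives in Euclidean space.\<close>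

definition opt_V :: "real ^ ('s \<times> 'a) \<Rightarrow> 's \<Rightarrow> real" where
  "opt_V r s = (SOME V::real ^ 's. \<forall>s. V $ s = \<tau> * ln (\<Sum>a\<in>UNIV.
     exp ((r $ (s, a) + \<gamma> * measure_pmf.expectation (P s a) (\<lambda>s'. V $ s')) / \<tau>))) $ s"

definition opt_Q :: "real ^ ('s \<times> 'a) \<Rightarrow> 's \<Rightarrow> 'a \<Rightarrow> real" where
  "opt_Q r s a = r $ (s, a) + \<gamma> * measure_pmf.expectation (P s a) (opt_V r)"

definition opt_pi :: "real ^ ('s \<times> 'a) \<Rightarrow> 's \<Rightarrow> 'a pmf" where
  "opt_pi r s = embed_pmf (\<lambda>a. exp ((opt_Q r s a - opt_V r s) / \<tau>))"

lemma opt_V_eq: "opt_V r s = \<tau> * ln (\<Sum>a\<in>UNIV. exp (opt_Q r s a / \<tau>))"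
  using someI_ex[OF ex_soft_Bellman[of r]]
  unfolding opt_Q_def opt_V_def[abs_def] by blast

lemma pmf_opt_pi: "pmf (opt_pi r s) a = exp ((opt_Q r s a - opt_V r s) / \<tau>)"
  unfolding opt_pi_def
  by (rule pmf_embed_finite) (auto simp: opt_V_eq sum_softmax[OF tau])

lemma soft_value_eq_Vval:
  "soft_value P \<gamma> \<tau> r \<pi> s = Vval \<pi> (\<lambda>z. r $ z + \<tau> * entropy_pmf (\<pi> (fst z))) s"
  unfolding soft_value_def Vval_def Qval_def
  using gamma by (subst integral_sa_process[where 'e=real, unfolded real_scaleR_def]) auto

lemma soft_Bellman_rhs:
  "measure_pmf.expectation (\<pi> s) (\<lambda>a. (r $ (s, a) + \<tau> * entropy_pmf (\<pi> (fst (s, a))))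
      + \<gamma> *\<^sub>R measure_pmf.expectation (P s a) V)
   = measure_pmf.expectation (\<pi> s) (\<lambda>a. r $ (s, a) + \<gamma> * measure_pmf.expectation (P s a) V)
     + \<tau> * entropy_pmf (\<pi> s)"
proof -
  have "measure_pmf.expectation (\<pi> s) (\<lambda>a. (r $ (s, a) + \<tau> * entropy_pmf (\<pi> (fst (s, a))))
      + \<gamma> *\<^sub>R measure_pmf.expectation (P s a) V)
    = measure_pmf.expectation (\<pi> s) (\<lambda>a. (r $ (s, a) + \<gamma> * measure_pmf.expectation (P s a) V)
      + \<tau> * entropy_pmf (\<pi> s))"
    by (simp add: algebra_simps)
  also have "\<dots> = measure_pmf.expectation (\<pi> s) (\<lambda>a. r $ (s, a) + \<gamma> * measure_pmf.expectation (P s a) V)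
     + \<tau> * entropy_pmf (\<pi> s)"
    by (subst expectation_add) simp
  finally show ?thesis .
qed

lemma soft_value_Bellman:
  "soft_value P \<gamma> \<tau> r \<pi> s = measure_pmf.expectation (\<pi> s)
      (\<lambda>a. r $ (s, a) + \<gamma> * measure_pmf.expectation (P s a) (soft_value P \<gamma> \<tau> r \<pi>))
    + \<tau> * entropy_pmf (\<pi> s)"
  unfolding soft_Bellman_rhs[symmetric]
  unfolding soft_value_eq_Vval[abs_def]
  by (rule Vval_Bellman)

text \<open>A one-sided contraction: by the Gibbs inequality the signed difference, if bounded by
  \<open>M\<close>, is bounded by \<open>\<gamma> * M\<close>, which forces it to be at most
  zero.\<close>

lemma soft_value_le_opt_V: "soft_value P \<gamma> \<tau> r \<pi> s \<le> opt_V r s"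
proof -
  let ?V = "soft_value P \<gamma> \<tau> r \<pi>"
  have "?V s - opt_V r s \<le> 0 / (1 - \<gamma>)"
  proof (rule contraction_bound[OF gamma(2)])
    fix s M assume M: "\<And>s. ?V s - opt_V r s \<le> M"
    have "?V s = measure_pmf.expectation (\<pi> s) (\<lambda>a. opt_Q r s a
        + \<gamma> * measure_pmf.expectation (P s a) (\<lambda>s'. ?V s' - opt_V r s')) + \<tau> * entropy_pmf (\<pi> s)"
      by (subst soft_value_Bellman) (simp add: opt_Q_def expectation_diff algebra_simps)
    also have "\<dots> = measure_pmf.expectation (\<pi> s) (\<lambda>a. \<gamma> * measure_pmf.expectation (P s a) (\<lambda>s'. ?V s' - opt_V r s'))
        + (measure_pmf.expectation (\<pi> s) (opt_Q r s) + \<tau> * entropy_pmf (\<pi> s))"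
      by (subst expectation_add) simp
    also have "\<dots> \<le> \<gamma> * M + opt_V r s"
      using gamma
      by (intro add_mono expectation_le mult_left_mono M gibbs_le tau opt_V_eq) auto
    finally show "?V s - opt_V r s \<le> 0 + \<gamma> * M" by simp
  qed
  then show ?thesis by simp
qed

lemma soft_value_opt_pi: "soft_value P \<gamma> \<tau> r (opt_pi r) s = opt_V r s"
  unfolding soft_value_eq_Vval
proof (rule Vval_unique[symmetric], unfold soft_Bellman_rhs)
  fix s
  show "opt_V r s = measure_pmf.expectation (opt_pi r s)
      (\<lambda>a. r $ (s, a) + \<gamma> * measure_pmf.expectation (P s a) (opt_V r)) + \<tau> * entropy_pmf (opt_pi r s)"
    using gibbs_eq_iff[OF tau opt_V_eq[of r s], of "opt_pi r s"]
    by (simp add: pmf_opt_pi opt_Q_def[abs_def])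
qed

text \<open>Optimal values make the Gibbs inequality an equality at every state, and its equality
  case determines the policy.\<close>

lemma eq_opt_pi:
  assumes "\<And>s. soft_value P \<gamma> \<tau> r \<pi> s = opt_V r s"
  shows "\<pi> = opt_pi r"
proof (intro ext pmf_eqI)
  fix s a
  have "soft_value P \<gamma> \<tau> r \<pi> = opt_V r" using assms by auto
  then have "measure_pmf.expectation (\<pi> s) (opt_Q r s) + \<tau> * entropy_pmf (\<pi> s) = opt_V r s"
    using soft_value_Bellman[of r \<pi> s] by (simp add: opt_Q_def[abs_def])
  then show "pmf (\<pi> s) a = pmf (opt_pi r s) a"
    by (simp add: gibbs_eq_iff[OF tau opt_V_eq] pmf_opt_pi)
qed

text \<open>The softmax policy is optimal in all states at once. Conversely, since all weights
  \<open>pmf \<rho> s\<close> are positive, a maximizer of the weighted sum attains the optimal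
  value at each state. This gives the uniqueness that \<open>THE\<close> demands.\<close>

lemma optimal_policy_eq_opt_pi:
  assumes \<rho>: "\<And>s. pmf \<rho> s > 0"
  shows "optimal_policy P \<gamma> \<tau> \<rho> r = opt_pi r"
  unfolding optimal_policy_def
proof (rule the_equality)
  let ?J = "\<lambda>\<pi>. \<Sum>s\<in>UNIV. pmf \<rho> s * soft_value P \<gamma> \<tau> r \<pi> s"
  have le: "pmf \<rho> s * soft_value P \<gamma> \<tau> r \<pi> s \<le> pmf \<rho> s * opt_V r s" for \<pi> s
    by (intro mult_left_mono soft_value_le_opt_V) auto
  show "is_arg_max ?J (\<lambda>_. True) (opt_pi r)"
    unfolding is_arg_max_def soft_value_opt_pi using le by (auto simp: not_less intro!: sum_mono)
  fix \<pi> assume "is_arg_max ?J (\<lambda>_. True) \<pi>"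
  then have "?J (opt_pi r) \<le> ?J \<pi>"
    by (auto simp: is_arg_max_def not_less)
  then have "(\<Sum>s\<in>UNIV. pmf \<rho> s * opt_V r s) \<le> ?J \<pi>"
    unfolding soft_value_opt_pi .
  moreover have "?J \<pi> \<le> (\<Sum>s\<in>UNIV. pmf \<rho> s * opt_V r s)"
    by (intro sum_mono le)
  ultimately have eq: "?J \<pi> = (\<Sum>s\<in>UNIV. pmf \<rho> s * opt_V r s)"
    by (rule antisym[rotated])
  have *: "pmf \<rho> s * soft_value P \<gamma> \<tau> r \<pi> s = pmf \<rho> s * opt_V r s" for s
    by (rule sum_mono_inv[OF eq le UNIV_I finite])
  have "soft_value P \<gamma> \<tau> r \<pi> s = opt_V r s" for s
    using *[of s] \<rho>[of s] by simp
  then show "\<pi> = opt_pi r" by (rule eq_opt_pi)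
qed

section \<open>Dependence of the optimal value on the reward\<close>

lemma soft_value_diff:
  "soft_value P \<gamma> \<tau> r\<^sub>1 \<pi> s - soft_value P \<gamma> \<tau> r\<^sub>0 \<pi> s = Vval \<pi> (\<lambda>z. (r\<^sub>1 - r\<^sub>0) $ z) s"
  unfolding soft_value_eq_Vval Vval_diff[symmetric] by simp

text \<open>\<open>opt_V\<close> is a maximum of affine functions of the reward,
  so a maximizer at either end of a segment bounds its increment.\<close>

lemma opt_V_diff_ge: "Vval (opt_pi r\<^sub>0) (\<lambda>z. (r\<^sub>1 - r\<^sub>0) $ z) s \<le> opt_V r\<^sub>1 s - opt_V r\<^sub>0 s"
  using soft_value_diff[of r\<^sub>1 "opt_pi r\<^sub>0" s r\<^sub>0] soft_value_le_opt_V[of r\<^sub>1 "opt_pi r\<^sub>0" s]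
  by (simp add: soft_value_opt_pi)

lemma opt_V_diff_le: "opt_V r\<^sub>1 s - opt_V r\<^sub>0 s \<le> Vval (opt_pi r\<^sub>1) (\<lambda>z. (r\<^sub>1 - r\<^sub>0) $ z) s"
  using soft_value_diff[of r\<^sub>1 "opt_pi r\<^sub>1" s r\<^sub>0] soft_value_le_opt_V[of r\<^sub>0 "opt_pi r\<^sub>1" s]
  by (simp add: soft_value_opt_pi)

text \<open>A first crude use of the envelope bounds, for continuity only: it makes the optimal
  policy continuous in the reward, which the derivative below requires.\<close>

lemma opt_V_Lipschitz: "\<bar>opt_V r\<^sub>1 s - opt_V r\<^sub>0 s\<bar> \<le> norm (r\<^sub>1 - r\<^sub>0) / (1 - \<gamma>)"
proof -
  have "norm (Vval \<pi> (\<lambda>z. (r\<^sub>1 - r\<^sub>0) $ z) s) \<le> norm (r\<^sub>1 - r\<^sub>0) / (1 - \<gamma>)" for \<pi>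
    by (intro norm_Vval_le Finite_Cartesian_Product.norm_nth_le)
  from this[of "opt_pi r\<^sub>0"] this[of "opt_pi r\<^sub>1"] show ?thesis
    using opt_V_diff_ge[of r\<^sub>0 r\<^sub>1 s] opt_V_diff_le[of r\<^sub>1 s r\<^sub>0] by (simp add: abs_le_iff)
qed

lemma tendsto_opt_V: "((\<lambda>r. opt_V r s) \<longlongrightarrow> opt_V r\<^sub>0 s) (at r\<^sub>0)"
proof (rule LIM_zero_cancel, rule Lim_null_comparison)
  show "\<forall>\<^sub>F r in at r\<^sub>0. norm (opt_V r s - opt_V r\<^sub>0 s) \<le> norm (r - r\<^sub>0) / (1 - \<gamma>)"
    using opt_V_Lipschitz by (auto intro: always_eventually)
  have "((\<lambda>r. norm (r - r\<^sub>0) / (1 - \<gamma>)) \<longlongrightarrow> norm (r\<^sub>0 - r\<^sub>0) / (1 - \<gamma>)) (at r\<^sub>0)"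
    using gamma by (intro tendsto_intros) auto
  then show "((\<lambda>r. norm (r - r\<^sub>0) / (1 - \<gamma>)) \<longlongrightarrow> 0) (at r\<^sub>0)" by simp
qed

lemma tendsto_pmf_opt_pi: "((\<lambda>r. pmf (opt_pi r s) a) \<longlongrightarrow> pmf (opt_pi r\<^sub>0 s) a) (at r\<^sub>0)"
  unfolding pmf_opt_pi opt_Q_def expectation_eq_sum_UNIV
  using tau by (intro tendsto_intros tendsto_opt_V) auto

lemma has_derivative_opt_V:
  "((\<lambda>r. opt_V r s) has_derivative (\<lambda>h. Vval (opt_pi r\<^sub>0) (\<lambda>z. h $ z) s)) (at r\<^sub>0)"
proof (rule has_derivativeI[OF bounded_linear_Vval])
  \<comment> \<open>A sum over the states rather than a maximum: it still dominates each distance,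
    and its limit follows termwise.\<close>
  define \<delta> where "\<delta> r = (\<Sum>s\<in>UNIV. l1_dist (opt_pi r s) (opt_pi r\<^sub>0 s))" for r
  have \<delta>_le: "l1_dist (opt_pi r s) (opt_pi r\<^sub>0 s) \<le> \<delta> r" for r s
    unfolding \<delta>_def by (intro member_le_sum) auto
  have "((\<lambda>r. \<delta> r) \<longlongrightarrow> (\<Sum>s\<in>(UNIV::'s set). \<Sum>a\<in>(UNIV::'a set).
      \<bar>pmf (opt_pi r\<^sub>0 s) a - pmf (opt_pi r\<^sub>0 s) a\<bar>)) (at r\<^sub>0)"
    unfolding \<delta>_def l1_dist_UNIV by (intro tendsto_intros tendsto_pmf_opt_pi)
  then have "(\<delta> \<longlongrightarrow> 0) (at r\<^sub>0)" by simp
  then have lim: "((\<lambda>r. \<delta> r / (1 - \<gamma>) / (1 - \<gamma>)) \<longlongrightarrow> 0) (at r\<^sub>0)"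
    using gamma by (auto intro!: tendsto_divide_zero)
  show "((\<lambda>r. (opt_V r s - opt_V r\<^sub>0 s - Vval (opt_pi r\<^sub>0) (\<lambda>z. (r - r\<^sub>0) $ z) s) /\<^sub>R norm (r - r\<^sub>0))
      \<longlongrightarrow> 0) (at r\<^sub>0)"
  proof (rule Lim_null_comparison[OF always_eventually lim], rule allI)
    fix r
    let ?h = "\<lambda>z. (r - r\<^sub>0) $ z"
    let ?e = "opt_V r s - opt_V r\<^sub>0 s - Vval (opt_pi r\<^sub>0) ?h s"
    \<comment> \<open>By the two envelope bounds the error \<open>?e\<close> lies between zero and
      the difference of the two linearizations, taken at \<open>r\<close> and at
      \<open>r\<^sub>0\<close>. Only the policy differs there, so the difference is
      \<open>\<delta> r\<close> times a multiple of \<open>norm (r - r\<^sub>0)\<close>.\<close>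
    have "\<bar>?e\<bar> \<le> norm (Vval (opt_pi r) ?h s - Vval (opt_pi r\<^sub>0) ?h s)"
      using opt_V_diff_ge[of r\<^sub>0 r s] opt_V_diff_le[of r s r\<^sub>0] by simp
    also have "\<dots> \<le> (0 + \<delta> r * norm (r - r\<^sub>0) / (1 - \<gamma>)) / (1 - \<gamma>)"
      by (rule Vval_perturb[OF Finite_Cartesian_Product.norm_nth_le _ \<delta>_le]) simp
    finally have *: "\<bar>?e\<bar> \<le> \<delta> r / (1 - \<gamma>) / (1 - \<gamma>) * norm (r - r\<^sub>0)" by simp
    show "norm (?e /\<^sub>R norm (r - r\<^sub>0)) \<le> \<delta> r / (1 - \<gamma>) / (1 - \<gamma>)"
    proof (cases "r = r\<^sub>0")
      case True
      have "0 \<le> \<delta> r" unfolding \<delta>_def by (intro sum_nonneg) auto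
      with True show ?thesis using gamma by simp
    next
      case False
      then show ?thesis using * by (simp add: abs_mult field_simps)
    qed
  qed
qed

end

section \<open>Gradients\<close>

lemma GDERIV_sum:
  assumes "\<And>i. i \<in> A \<Longrightarrow> GDERIV (f i) x :> D i"
  shows "GDERIV (\<lambda>x. \<Sum>i\<in>A. f i x) x :> (\<Sum>i\<in>A. D i)"
  using assms unfolding gderiv_def by (auto simp: inner_sum_right intro!: has_derivative_sum)

lemma GDERIV_cmult:
  assumes "GDERIV f x :> D"
  shows "GDERIV (\<lambda>x. c * f x) x :> c *\<^sub>R D"
  using GDERIV_mult[OF GDERIV_const assms, of c] by simp

text \<open>The log-derivative trick without logarithms: the scores \<open>g i\<close> add up, and
  factors are allowed to vanish, as trajectory probabilities may.\<close>

lemma GDERIV_prod_log: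
  assumes "finite A" "\<And>i. i \<in> A \<Longrightarrow> GDERIV (f i) x :> f i x *\<^sub>R g i"
  shows "GDERIV (\<lambda>x. \<Prod>i\<in>A. f i x) x :> (\<Prod>i\<in>A. f i x) *\<^sub>R (\<Sum>i\<in>A. g i)"
  using assms
proof (induction A rule: finite_induct)
  case empty
  then show ?case by (simp add: GDERIV_const)
next
  case (insert j A)
  have "GDERIV (\<lambda>x. f j x * (\<Prod>i\<in>A. f i x)) x :>
      f j x *\<^sub>R ((\<Prod>i\<in>A. f i x) *\<^sub>R (\<Sum>i\<in>A. g i)) + (\<Prod>i\<in>A. f i x) *\<^sub>R (f j x *\<^sub>R g j)"
    using insert by (intro GDERIV_mult) auto
  then show ?case using insert(1,2) by (simp add: scaleR_add_right mult_ac add_ac)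
qed

lemma GDERIV_vec:
  fixes r :: "'x::real_inner \<Rightarrow> real ^ 'k::finite"
  assumes "\<And>z. GDERIV (\<lambda>y. r y $ z) x :> g z"
  shows "(r has_derivative (\<lambda>h. \<chi> z. inner h (g z))) (at x)"
  using assms
  by (subst has_derivative_componentwise_within)
     (auto simp: Basis_vec_def inner_axis gderiv_def)

lemma GDERIV_gradient:
  assumes "continuously_differentiable f"
  shows "GDERIV f x :> gradient f x"
  using assms gradient_eqI unfolding continuously_differentiable_def by metis

lemma GDERIV_line:
  assumes "GDERIV f (x + t *\<^sub>R v) :> D"
  shows "((\<lambda>t. f (x + t *\<^sub>R v)) has_real_derivative inner v D) (at t)"
proof -
  have "((\<lambda>t. x + t *\<^sub>R v) has_derivative (\<lambda>h. h *\<^sub>R v)) (at t)"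
    by (auto intro!: derivative_eq_intros)
  from has_derivative_compose[OF this assms[unfolded gderiv_def]]
  show ?thesis by (simp add: has_field_derivative_def mult_commute_abs)
qed

text \<open>The difference quotients along the direction \<open>D\<close> itself are bounded by
  \<open>L * norm D\<close> and converge to \<open>inner D D\<close>. Applied to \<open>l\<close>,
  this turns \<open>L_l\<close> into a gradient bound.\<close>

lemma norm_GDERIV_le:
  assumes L: "0 \<le> L" and D: "GDERIV f x :> D"
    and lip: "\<And>y. \<bar>f y - f x\<bar> \<le> L * norm (y - x)"
  shows "norm D \<le> L"
proof (cases "D = 0")
  case True
  with L show ?thesis by simp
next
  case False
  have "GDERIV f (x + 0 *\<^sub>R D) :> D" using D by simp
  from GDERIV_line[OF this]
  have "((\<lambda>h. (f (x + h *\<^sub>R D) - f x) / h) \<longlongrightarrow> inner D D) (at 0)"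
    by (simp add: DERIV_def)
  moreover have "\<forall>\<^sub>F h in at 0. norm ((f (x + h *\<^sub>R D) - f x) / h) \<le> L * norm D"
  proof (rule eventually_at_topological[THEN iffD2], intro exI[of _ UNIV] conjI ballI impI)
    fix h :: real assume "h \<noteq> 0"
    then show "norm ((f (x + h *\<^sub>R D) - f x) / h) \<le> L * norm D"
      using lip[of "x + h *\<^sub>R D"] by (simp add: field_simps)
  qed auto
  ultimately have "norm (inner D D) \<le> L * norm D"
    by (intro Lim_norm_ubound) auto
  then have "norm D * norm D \<le> L * norm D"
    by (simp add: power2_norm_eq_inner[symmetric] power2_eq_square)
  with False show ?thesis by simp
qed

lemma GDERIV_Lipschitz:
  fixes f :: "'x::real_inner \<Rightarrow> real"
  assumes D: "\<And>x. GDERIV f x :> D x" and B: "\<And>x. norm (D x) \<le> B"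
  shows "\<bar>f x - f y\<bar> \<le> B * norm (x - y)"
proof -
  have "norm (f x - f y) \<le> B * norm (x - y)"
  proof (rule differentiable_bound)
    show "(f has_derivative (\<lambda>h. inner h (D z))) (at z within UNIV)" for z
      using D by (simp add: gderiv_def)
    show "onorm (\<lambda>h. inner h (D z)) \<le> B" for z
    proof (rule onorm_bound)
      show "0 \<le> B" using B[of z] norm_ge_zero order_trans by blast
      show "norm (inner h (D z)) \<le> B * norm h" for h
        using Cauchy_Schwarz_ineq2[of h "D z"] mult_right_mono[OF B[of z], of "norm h"]
        by (simp add: mult.commute)
    qed
  qed auto
  then show ?thesis by simp
qed

lemma descent_lemma:
  fixes f :: "'x::real_inner \<Rightarrow> real"
  assumes D: "\<And>x. GDERIV f x :> D x" and lip: "\<And>x y. norm (D x - D y) \<le> L * norm (x - y)"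
  shows "f (x + v) \<le> f x + inner (D x) v + L / 2 * (norm v)\<^sup>2"
proof -
  \<comment> \<open>The defect of the quadratic upper model along the segment. The Lipschitz
    gradient makes it nonincreasing, and comparing its endpoints is the claim.\<close>
  define g where "g t = f (x + t *\<^sub>R v) - t * inner (D x) v - L / 2 * t\<^sup>2 * (norm v)\<^sup>2" for t :: real
  have "g 1 \<le> g 0"
  proof (rule DERIV_nonpos_imp_nonincreasing[of 0 1 g])
    fix t :: real assume t: "0 \<le> t" "t \<le> 1"
    have "(g has_real_derivative inner v (D (x + t *\<^sub>R v)) - inner (D x) v - L * t * (norm v)\<^sup>2) (at t)"
      unfolding g_def by (auto intro!: derivative_eq_intros GDERIV_line D)
    moreover have "inner v (D (x + t *\<^sub>R v)) - inner (D x) v - L * t * (norm v)\<^sup>2 \<le> 0"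
    proof -
      have "inner v (D (x + t *\<^sub>R v)) - inner (D x) v = inner v (D (x + t *\<^sub>R v) - D x)"
        by (simp add: inner_diff_right inner_commute)
      also have "\<dots> \<le> norm v * norm (D (x + t *\<^sub>R v) - D x)" by (rule norm_cauchy_schwarz)
      also have "\<dots> \<le> norm v * (L * norm (t *\<^sub>R v))"
        using lip[of "x + t *\<^sub>R v" x] by (intro mult_left_mono) auto
      also have "\<dots> = L * t * (norm v)\<^sup>2" using t by (simp add: power2_eq_square)
      finally show ?thesis by simp
    qed
    ultimately show "\<exists>y. (g has_real_derivative y) (at t) \<and> y \<le> 0" by blast
  qed auto
  then show ?thesis by (simp add: g_def)
qed

section \<open>Comparing entrywise, l1 and Euclidean distances of policies\<close>

lemma norm_vec_le_sqrt_card: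
  fixes v :: "real ^ 'k::finite"
  assumes "\<And>z. \<bar>v $ z\<bar> \<le> c"
  shows "norm v \<le> sqrt CARD('k) * c"
proof -
  have c: "0 \<le> c" using assms[of undefined] by linarith
  have "(\<Sum>z\<in>UNIV. (norm (v $ z))\<^sup>2) \<le> (\<Sum>z\<in>(UNIV::'k set). c\<^sup>2)"
    using assms by (intro sum_mono power_mono) auto
  then have "norm v \<le> sqrt (real CARD('k) * c\<^sup>2)"
    unfolding norm_vec_def L2_set_def by simp
  with c show ?thesis by (simp add: real_sqrt_mult)
qed

text \<open>Cauchy-Schwarz against the constant one over the actions of state \<open>s\<close>,
  whose block of coordinates has at most the norm of the whole vector. Hence the factor involves
  \<open>CARD('a)\<close> alone and not the number of states.\<close>

lemma l1_dist_le_policy_vec: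
  fixes \<pi>\<^sub>1 \<pi>\<^sub>2 :: "'s::finite \<Rightarrow> 'a::finite pmf"
  shows "l1_dist (\<pi>\<^sub>1 s) (\<pi>\<^sub>2 s) \<le> sqrt CARD('a) * norm (policy_vec \<pi>\<^sub>1 - policy_vec \<pi>\<^sub>2)"
proof -
  let ?v = "policy_vec \<pi>\<^sub>1 - policy_vec \<pi>\<^sub>2"
  have "l1_dist (\<pi>\<^sub>1 s) (\<pi>\<^sub>2 s) = (\<Sum>a\<in>UNIV. \<bar>?v $ (s, a)\<bar> * \<bar>1\<bar>)"
    by (simp add: l1_dist_UNIV policy_vec_def)
  also have "\<dots> \<le> L2_set (\<lambda>a. ?v $ (s, a)) UNIV * L2_set (\<lambda>a::'a. 1) UNIV"
    by (rule L2_set_mult_ineq)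
  also have "L2_set (\<lambda>a::'a. 1) UNIV = sqrt CARD('a)"
    by (simp add: L2_set_def)
  also have "L2_set (\<lambda>a. ?v $ (s, a)) UNIV \<le> norm ?v"
  proof -
    have "(\<Sum>a\<in>UNIV. (?v $ (s, a))\<^sup>2) = (\<Sum>z\<in>range (Pair s). (?v $ z)\<^sup>2)"
      by (subst sum.reindex) (auto simp: inj_on_def)
    also have "\<dots> \<le> (\<Sum>z\<in>UNIV. (?v $ z)\<^sup>2)"
      by (intro sum_mono2) auto
    finally show ?thesis unfolding norm_vec_def L2_set_def by simp
  qed
  finally show ?thesis by (simp add: mult_ac mult_left_mono)
qed

section \<open>Trajectories of the upper level\<close>

lemma finite_set_path_pmf:
  fixes Pb :: "'s::finite \<Rightarrow> 'a::finite \<Rightarrow> 's pmf"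
  shows "finite (set_pmf (path_pmf Pb \<pi> n s))"
  by (induction n arbitrary: s) auto

text \<open>\<open>path_pmf\<close> with index \<open>n\<close> draws \<open>Suc n\<close> actions,
  each costing \<open>\<delta>\<close>; the transitions are common to both laws and cost
  nothing.\<close>

lemma l1_dist_path_le:
  fixes Pb :: "'s::finite \<Rightarrow> 'a::finite \<Rightarrow> 's pmf"
  assumes \<delta>: "\<And>s. l1_dist (\<pi>\<^sub>1 s) (\<pi>\<^sub>2 s) \<le> \<delta>"
  shows "l1_dist (path_pmf Pb \<pi>\<^sub>1 n s) (path_pmf Pb \<pi>\<^sub>2 n s) \<le> real (Suc n) * \<delta>"
proof (induction n arbitrary: s)
  case 0
  have "l1_dist (path_pmf Pb \<pi>\<^sub>1 0 s) (path_pmf Pb \<pi>\<^sub>2 0 s) \<le> l1_dist (\<pi>\<^sub>1 s) (\<pi>\<^sub>2 s)"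
    unfolding path_pmf.simps by (rule l1_dist_map_le) auto
  with \<delta>[of s] show ?case by simp
next
  case (Suc n)
  have "l1_dist (path_pmf Pb \<pi>\<^sub>1 (Suc n) s) (path_pmf Pb \<pi>\<^sub>2 (Suc n) s)
      \<le> l1_dist (\<pi>\<^sub>1 s) (\<pi>\<^sub>2 s) + real (Suc n) * \<delta>"
    unfolding path_pmf.simps
  proof (rule l1_dist_bind_le)
    fix a
    have "l1_dist (bind_pmf (Pb s a) (\<lambda>s'. map_pmf ((#) (s, a)) (path_pmf Pb \<pi>\<^sub>1 n s')))
        (bind_pmf (Pb s a) (\<lambda>s'. map_pmf ((#) (s, a)) (path_pmf Pb \<pi>\<^sub>2 n s')))
        \<le> l1_dist (Pb s a) (Pb s a) + real (Suc n) * \<delta>"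
      using Suc
      by (intro l1_dist_bind_le)
         (auto intro!: l1_dist_map_le[THEN order_trans] simp: finite_set_path_pmf simp del: of_nat_Suc)
    then show "l1_dist (bind_pmf (Pb s a) (\<lambda>s'. map_pmf ((#) (s, a)) (path_pmf Pb \<pi>\<^sub>1 n s')))
        (bind_pmf (Pb s a) (\<lambda>s'. map_pmf ((#) (s, a)) (path_pmf Pb \<pi>\<^sub>2 n s')))
        \<le> real (Suc n) * \<delta>" by simp
  qed (auto simp: finite_set_path_pmf)
  with \<delta>[of s] show ?case by (simp add: algebra_simps)
qed

context
  fixes Pb :: "'s::finite \<Rightarrow> 'a::finite \<Rightarrow> 's pmf" and \<rho>b :: "'s pmf" and I H :: nat
  assumes H: "H \<ge> 1"
begin

lemma finite_set_traj_pmf: "finite (set_pmf (traj_pmf Pb \<rho>b H \<pi>))"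
  by (auto simp: traj_pmf_eq[OF H] finite_set_path_pmf)

lemma l1_dist_traj_le:
  assumes "\<And>s. l1_dist (\<pi>\<^sub>1 s) (\<pi>\<^sub>2 s) \<le> \<delta>"
  shows "l1_dist (traj_pmf Pb \<rho>b H \<pi>\<^sub>1) (traj_pmf Pb \<rho>b H \<pi>\<^sub>2) \<le> real H * \<delta>"
proof -
  have "l1_dist (traj_pmf Pb \<rho>b H \<pi>\<^sub>1) (traj_pmf Pb \<rho>b H \<pi>\<^sub>2)
      \<le> l1_dist \<rho>b \<rho>b + real (Suc (H - 1)) * \<delta>"
    unfolding traj_pmf_eq[OF H]
    by (intro l1_dist_bind_le l1_dist_path_le assms) (auto simp: finite_set_path_pmf)
  with H show ?thesis by simp
qed

lemma finite_set_tuple_pmf: "finite (set_pmf (replicate_pmf I (traj_pmf Pb \<rho>b H \<pi>)))"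
  by (intro finite_set_replicate_pmf finite_set_traj_pmf)

lemma l1_dist_tuple_le:
  assumes "\<And>s. l1_dist (\<pi>\<^sub>1 s) (\<pi>\<^sub>2 s) \<le> \<delta>"
  shows "l1_dist (replicate_pmf I (traj_pmf Pb \<rho>b H \<pi>\<^sub>1)) (replicate_pmf I (traj_pmf Pb \<rho>b H \<pi>\<^sub>2))
    \<le> real H * real I * \<delta>"
proof -
  have "l1_dist (replicate_pmf I (traj_pmf Pb \<rho>b H \<pi>\<^sub>1)) (replicate_pmf I (traj_pmf Pb \<rho>b H \<pi>\<^sub>2))
      \<le> real I * l1_dist (traj_pmf Pb \<rho>b H \<pi>\<^sub>1) (traj_pmf Pb \<rho>b H \<pi>\<^sub>2)"
    by (intro l1_dist_replicate_le finite_set_traj_pmf)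
  also have "\<dots> \<le> real I * (real H * \<delta>)"
    by (intro mult_left_mono l1_dist_traj_le assms) auto
  finally show ?thesis by (simp add: mult_ac)
qed

lemma finite_traj_tuples: "finite (traj_tuples I H :: ('s \<times> 'a) list list set)"
proof -
  have "traj_tuples I H = {ds. set ds \<subseteq> {d. set d \<subseteq> (UNIV :: ('s \<times> 'a) set) \<and> length d = H} \<and> length ds = I}"
    by (auto simp: traj_tuples_def)
  also have "finite \<dots>" by (intro finite_lists_length_eq) auto
  finally show ?thesis .
qed

lemma pmf_tuple:
  "pmf (replicate_pmf I (traj_pmf Pb \<rho>b H \<pi>)) ds
    = (if ds \<in> traj_tuples I H then \<Prod>i<I. traj_prob Pb \<rho>b H \<pi> (ds ! i) else 0)"
proof (cases "ds \<in> traj_tuples I H")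
  case True
  then show ?thesis
    by (simp add: pmf_replicate_pmf[OF finite_set_traj_pmf] pmf_traj_pmf[OF H] traj_tuples_def)
next
  case False
  have "(\<Prod>i<I. pmf (traj_pmf Pb \<rho>b H \<pi>) (ds ! i)) = 0" if "length ds = I"
  proof -
    from False that obtain i where "i < I" "length (ds ! i) \<noteq> H"
      by (auto simp: traj_tuples_def in_set_conv_nth)
    then show ?thesis by (intro prod_zero) (auto simp: pmf_traj_pmf[OF H])
  qed
  with False show ?thesis by (simp add: pmf_replicate_pmf[OF finite_set_traj_pmf])
qed

lemma set_tuple_pmf: "set_pmf (replicate_pmf I (traj_pmf Pb \<rho>b H \<pi>)) \<subseteq> traj_tuples I H"
  by (auto simp: set_pmf_iff pmf_tuple split: if_splits)

text \<open>The index set does not depend on the policy, unlike the support, so the expectation can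
  be differentiated term by term.\<close>

lemma expectation_tuple:
  fixes f :: "_ \<Rightarrow> 'e::{banach,second_countable_topology}"
  shows "measure_pmf.expectation (replicate_pmf I (traj_pmf Pb \<rho>b H \<pi>)) f
    = (\<Sum>ds\<in>traj_tuples I H. pmf (replicate_pmf I (traj_pmf Pb \<rho>b H \<pi>)) ds *\<^sub>R f ds)"
  by (rule expectation_eq_sum[OF finite_traj_tuples set_tuple_pmf])

lemma GDERIV_traj_prob:
  assumes "\<And>s a. GDERIV (\<lambda>y. pmf (\<pi> y s) a) x :> pmf (\<pi> x s) a *\<^sub>R \<sigma> s a"
  shows "GDERIV (\<lambda>y. traj_prob Pb \<rho>b H (\<pi> y) d) x :>
    traj_prob Pb \<rho>b H (\<pi> x) d *\<^sub>R (\<Sum>h<H. \<sigma> (fst (d ! h)) (snd (d ! h)))"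
proof -
  obtain m where m: "H = Suc m" using H by (cases H) auto
  \<comment> \<open>The policy-independent factor. A trajectory has \<open>H\<close> actions but
    only \<open>H - 1\<close> transitions, so the separate last action completes the product of
    policy factors to length \<open>H\<close>.\<close>
  define c where "c = pmf \<rho>b (fst (d ! 0))
    * (\<Prod>h<m. pmf (Pb (fst (d ! h)) (snd (d ! h))) (fst (d ! Suc h)))"
  have eq: "traj_prob Pb \<rho>b H \<pi> d = c * (\<Prod>h<H. pmf (\<pi> (fst (d ! h))) (snd (d ! h)))" for \<pi>
    unfolding traj_prob_def m c_def by (simp add: prod.distrib)
  have "GDERIV (\<lambda>y. c * (\<Prod>h<H. pmf (\<pi> y (fst (d ! h))) (snd (d ! h)))) x :>
      c *\<^sub>R (\<Prod>h<H. pmf (\<pi> x (fst (d ! h))) (snd (d ! h))) *\<^sub>R (\<Sum>h<H. \<sigma> (fst (d ! h)) (snd (d ! h)))"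
    by (intro GDERIV_cmult GDERIV_prod_log assms) auto
  then show ?thesis unfolding eq by simp
qed

lemma GDERIV_upper_objective:
  fixes l :: "('s \<times> 'a) list list \<Rightarrow> real ^ 'n \<Rightarrow> real"
  assumes \<pi>: "\<And>s a. GDERIV (\<lambda>y. pmf (\<pi> y s) a) x :> pmf (\<pi> x s) a *\<^sub>R \<sigma> s a"
    and l: "\<And>ds. ds \<in> traj_tuples I H \<Longrightarrow> GDERIV (l ds) x :> l' ds"
  shows "GDERIV (\<lambda>y. upper_objective Pb \<rho>b I H l y (\<pi> y)) x :>
    (LINT ds|measure_pmf (replicate_pmf I (traj_pmf Pb \<rho>b H (\<pi> x))). l' ds)
    + (LINT ds|measure_pmf (replicate_pmf I (traj_pmf Pb \<rho>b H (\<pi> x))).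
        l ds x *\<^sub>R (\<Sum>i<I. \<Sum>h<H. \<sigma> (fst (ds ! i ! h)) (snd (ds ! i ! h))))"
proof -
  define w where "w y ds = pmf (replicate_pmf I (traj_pmf Pb \<rho>b H (\<pi> y))) ds" for y ds
  define sc where "sc ds = (\<Sum>i<I. \<Sum>h<H. \<sigma> (fst (ds ! i ! h)) (snd (ds ! i ! h)))" for ds
  have w: "GDERIV (\<lambda>y. w y ds) x :> w x ds *\<^sub>R sc ds" if "ds \<in> traj_tuples I H" for ds
    using that unfolding w_def sc_def pmf_tuple
    by (simp, intro GDERIV_prod_log GDERIV_traj_prob \<pi>) auto
  have "GDERIV (\<lambda>y. \<Sum>ds\<in>traj_tuples I H. w y ds * l ds y) x :>
      (\<Sum>ds\<in>traj_tuples I H. w x ds *\<^sub>R l' ds + l ds x *\<^sub>R (w x ds *\<^sub>R sc ds))"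
    by (intro GDERIV_sum GDERIV_mult w l)
  then show ?thesis
    unfolding upper_objective_def expectation_tuple w_def[symmetric] sc_def[symmetric]
    by (simp add: sum.distrib mult_ac)
qed

end

section \<open>Gradients of the optimal value and policy\<close>

context soft_mdp
begin

text \<open>The chain rule gives the functional that sends \<open>h\<close> to \<open>Vval\<close>
  of \<open>inner h (g z)\<close>; as \<open>Vval\<close> commutes with linear maps, it is
  represented by the vector-valued \<open>Vval\<close> of \<open>g\<close>.\<close>

lemma GDERIV_opt_V:
  fixes r :: "'x::euclidean_space \<Rightarrow> real ^ ('s \<times> 'a)"
  assumes "\<And>z. GDERIV (\<lambda>y. r y $ z) x :> g z"
  shows "GDERIV (\<lambda>y. opt_V (r y) s) x :> Vval (opt_pi (r x)) g s"
proof -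
  have "linear (inner h)" for h :: 'x
    by (intro bounded_linear.linear bounded_linear_inner_right)
  then have "inner h (Vval (opt_pi (r x)) g s)
      = Vval (opt_pi (r x)) (\<lambda>z. (\<chi> z. inner h (g z)) $ z) s" for h
    by (simp add: Vval_linear[symmetric])
  then show ?thesis
    unfolding gderiv_def
    using has_derivative_compose[OF GDERIV_vec[OF assms] has_derivative_opt_V[of s "r x"]] by simp
qed

lemma GDERIV_opt_Q:
  fixes r :: "'x::euclidean_space \<Rightarrow> real ^ ('s \<times> 'a)"
  assumes "\<And>z. GDERIV (\<lambda>y. r y $ z) x :> g z"
  shows "GDERIV (\<lambda>y. opt_Q (r y) s a) x :> Qval (opt_pi (r x)) g s a"
  unfolding opt_Q_def Qval_Bellman expectation_eq_sum_UNIV real_scaleR_def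
  by (intro GDERIV_add GDERIV_cmult GDERIV_sum GDERIV_opt_V assms)

lemma GDERIV_pmf_opt_pi:
  fixes r :: "'x::euclidean_space \<Rightarrow> real ^ ('s \<times> 'a)"
  assumes "\<And>z. GDERIV (\<lambda>y. r y $ z) x :> g z"
  shows "GDERIV (\<lambda>y. pmf (opt_pi (r y) s) a) x :> pmf (opt_pi (r x) s) a *\<^sub>R
    (1 / \<tau>) *\<^sub>R (Qval (opt_pi (r x)) g s a - Vval (opt_pi (r x)) g s)"
proof -
  have "GDERIV (\<lambda>y. exp ((1 / \<tau>) * (opt_Q (r y) s a - opt_V (r y) s))) x :>
      exp ((1 / \<tau>) * (opt_Q (r x) s a - opt_V (r x) s)) *\<^sub>R
      (1 / \<tau>) *\<^sub>R (Qval (opt_pi (r x)) g s a - Vval (opt_pi (r x)) g s)"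
    by (intro GDERIV_DERIV_compose[where g=exp] DERIV_exp GDERIV_cmult GDERIV_diff
        GDERIV_opt_Q GDERIV_opt_V assms)
  then show ?thesis unfolding pmf_opt_pi by simp
qed

end

section \<open>The gradient estimator and gradient descent\<close>

text \<open>The signs of the constants are not assumed; they follow by testing the bounds at two
  distinct points.\<close>

lemma Lipschitz_const_nonneg:
  fixes L :: real
  assumes "\<And>y\<^sub>1 y\<^sub>2 :: real ^ 'n. 0 \<le> L * norm (y\<^sub>1 - y\<^sub>2)"
  shows "0 \<le> L"
proof -
  have "0 < norm ((1 :: real ^ 'n) - 0)" by simp
  with assms[of 1 0] show ?thesis by (simp add: zero_le_mult_iff)
qed

lemma norm_double_sum_le:
  fixes F :: "nat \<Rightarrow> nat \<Rightarrow> 'e::real_normed_vector"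
  assumes "\<And>i h. norm (F i h) \<le> B"
  shows "norm (\<Sum>i<m. \<Sum>h<n. F i h) \<le> real n * real m * B"
proof -
  have "norm (\<Sum>h<n. F i h) \<le> real n * B" for i
    using sum_norm_le[of "{..<n}" "F i" "\<lambda>_. B"] assms by simp
  then have "norm (\<Sum>i<m. \<Sum>h<n. F i h) \<le> real m * (real n * B)"
    using sum_norm_le[of "{..<m}" "\<lambda>i. \<Sum>h<n. F i h" "\<lambda>_. real n * B"] by simp
  then show ?thesis by (simp add: mult_ac)
qed

lemma norm_scaleR_diff_le:
  fixes u v :: "'e::real_normed_vector"
  assumes "\<bar>a - b\<bar> \<le> D" "\<bar>b\<bar> \<le> C" "norm u \<le> B" "norm (u - v) \<le> W"
  shows "norm (a *\<^sub>R u - b *\<^sub>R v) \<le> D * B + C * W"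
proof -
  have "a *\<^sub>R u - b *\<^sub>R v = (a - b) *\<^sub>R u + b *\<^sub>R (u - v)" by (simp add: algebra_simps)
  also have "norm \<dots> \<le> D * B + C * W"
    using assms by (intro norm_triangle_mono) (auto intro!: mult_mono)
  finally show ?thesis .
qed

section \<open>Gradient descent with inexact gradients\<close>

lemma inexact_descent_step:
  fixes f :: "'x::real_inner \<Rightarrow> real"
  assumes D: "\<And>x. GDERIV f x :> D x" and lip: "\<And>x y. norm (D x - D y) \<le> L * norm (x - y)"
    and L: "0 \<le> L" and \<beta>: "0 < \<beta>"
  shows "f (x - \<beta> *\<^sub>R g) \<le> f x - (\<beta> / 2 - \<beta>\<^sup>2 * L) * (norm (D x))\<^sup>2
    + (\<beta> / 2 + \<beta>\<^sup>2 * L) * (norm (g - D x))\<^sup>2"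
proof -
  define G e where "G = D x" and "e = g - D x"
  have g: "g = G + e" by (simp add: G_def e_def)
  have "f (x - \<beta> *\<^sub>R g) \<le> f x + inner G (- (\<beta> *\<^sub>R g)) + L / 2 * (norm (- (\<beta> *\<^sub>R g)))\<^sup>2"
    using descent_lemma[OF D lip, of x "- (\<beta> *\<^sub>R g)"] by (simp add: G_def)
  also have "\<dots> = f x - \<beta> * inner G g + \<beta>\<^sup>2 * L * ((norm g)\<^sup>2 / 2)"
    by (simp add: power_mult_distrib)
  also have "\<dots> \<le> f x - \<beta> * ((norm G)\<^sup>2 / 2 - (norm e)\<^sup>2 / 2) + \<beta>\<^sup>2 * L * ((norm G)\<^sup>2 + (norm e)\<^sup>2)"
  proof -
    \<comment> \<open>The first square bounds \<open>inner G g\<close> from below, the second bounds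
      \<open>(norm g)\<^sup>2\<close> from above. Together they produce the weights
      \<open>\<beta> / 2 - \<beta>\<^sup>2 * L\<close> and
      \<open>\<beta> / 2 + \<beta>\<^sup>2 * L\<close>.\<close>
    have "0 \<le> inner (G + e) (G + e)" "0 \<le> inner (G - e) (G - e)" by auto
    then have "inner G g \<ge> (norm G)\<^sup>2 / 2 - (norm e)\<^sup>2 / 2" "(norm g)\<^sup>2 / 2 \<le> (norm G)\<^sup>2 + (norm e)\<^sup>2"
      unfolding g power2_norm_eq_inner
      by (auto simp: inner_add_left inner_add_right inner_diff_left inner_diff_right inner_commute)
    then have "\<beta> * ((norm G)\<^sup>2 / 2 - (norm e)\<^sup>2 / 2) \<le> \<beta> * inner G g"
        "\<beta>\<^sup>2 * L * ((norm g)\<^sup>2 / 2) \<le> \<beta>\<^sup>2 * L * ((norm G)\<^sup>2 + (norm e)\<^sup>2)"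
      using \<beta> L by (auto intro!: mult_left_mono)
    then show ?thesis by linarith
  qed
  finally show ?thesis by (simp add: G_def e_def algebra_simps)
qed

lemma inexact_descent_rate:
  fixes f :: "'x::real_inner \<Rightarrow> real"
  assumes D: "\<And>x. GDERIV f x :> D x" and lip: "\<And>x y. norm (D x - D y) \<le> L * norm (x - y)"
    and L: "0 \<le> L" and \<beta>: "0 < \<beta>" "2 * \<beta> * L < 1"
    and step: "\<And>k. k \<in> {1..K} \<Longrightarrow> x (Suc k) = x k - \<beta> *\<^sub>R g k"
    and err: "\<And>k. k \<in> {1..K} \<Longrightarrow> (norm (g k - D (x k)))\<^sup>2 \<le> E"
    and K: "1 \<le> K" and lower: "\<And>y. m \<le> f y"
  shows "(1 / K) * (\<Sum>k=1..K. (norm (D (x k)))\<^sup>2)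
    \<le> (f (x 1) - m) / (K * (\<beta> / 2 - \<beta>\<^sup>2 * L)) + (1 + 2 * \<beta> * L) / (1 - 2 * \<beta> * L) * E"
proof -
  define c c' where "c = \<beta> / 2 - \<beta>\<^sup>2 * L" and "c' = \<beta> / 2 + \<beta>\<^sup>2 * L"
  \<comment> \<open>Positivity of \<open>c\<close> is exactly the step-size condition, and the
    common factor \<open>\<beta> / 2\<close> cancels in the ratio that multiplies the error.\<close>
  have c: "c = \<beta> / 2 * (1 - 2 * \<beta> * L)" and c': "c' = \<beta> / 2 * (1 + 2 * \<beta> * L)"
    by (simp_all add: c_def c'_def power2_eq_square algebra_simps)
  have c0: "0 < c" unfolding c using \<beta> by simp
  have c'0: "0 \<le> c'" unfolding c'_def using \<beta> L by simp
  \<comment> \<open>The telescoped descent steps; only indices up to \<open>K\<close> are available,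
    since the iteration is prescribed there alone.\<close>
  have "f (x (Suc n)) \<le> f (x 1) - c * (\<Sum>k=1..n. (norm (D (x k)))\<^sup>2) + real n * (c' * E)"
    if "n \<le> K" for n
    using that
  proof (induction n)
    case 0
    then show ?case by simp
  next
    case (Suc n)
    then have n: "Suc n \<in> {1..K}" by simp
    have "f (x (Suc (Suc n))) \<le> f (x (Suc n)) - c * (norm (D (x (Suc n))))\<^sup>2
        + c' * (norm (g (Suc n) - D (x (Suc n))))\<^sup>2"
      unfolding step[OF n] c_def c'_def by (intro inexact_descent_step D lip L \<beta>)
    also have "c' * (norm (g (Suc n) - D (x (Suc n))))\<^sup>2 \<le> c' * E"
      by (intro mult_left_mono err n c'0)
    finally show ?case using Suc by (simp add: algebra_simps)
  qed
  from this[OF order_refl] lower[of "x (Suc K)"]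
  have "c * (\<Sum>k=1..K. (norm (D (x k)))\<^sup>2) \<le> (f (x 1) - m) + real K * (c' * E)" by simp
  then have "(c * (\<Sum>k=1..K. (norm (D (x k)))\<^sup>2)) / (K * c) \<le> ((f (x 1) - m) + real K * (c' * E)) / (K * c)"
    using c0 K by (intro divide_right_mono) auto
  then have "(1 / K) * (\<Sum>k=1..K. (norm (D (x k)))\<^sup>2) \<le> (f (x 1) - m) / (K * c) + c' / c * E"
    using c0 K by (simp add: add_divide_distrib)
  also have "c' / c = (1 + 2 * \<beta> * L) / (1 - 2 * \<beta> * L)"
    unfolding c c' using \<beta> by simp
  finally show ?thesis unfolding c_def .
qed

section \<open>Lipschitz bounds for the estimator and the hyper-gradient\<close>

locale bilevel_mdp = soft_mdp P \<gamma> \<tau>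
  for P :: "'s::finite \<Rightarrow> 'a::finite \<Rightarrow> 's pmf" and \<gamma> \<tau> :: real +
  fixes Pb :: "'s \<Rightarrow> 'a \<Rightarrow> 's pmf" and \<rho> \<rho>b :: "'s pmf"
    and r :: "real ^ 'n \<Rightarrow> real ^ ('s \<times> 'a)"
    and l :: "('s \<times> 'a) list list \<Rightarrow> real ^ 'n \<Rightarrow> real"
    and I H :: nat
    and C_rx L_r C_l L_l L_l1 :: real
  assumes rho_pos: "\<And>s. pmf \<rho> s > 0"
    and H: "H \<ge> 1"
    and r_C1: "\<And>sa. continuously_differentiable (\<lambda>y. r y $ sa)"
    and grad_r_bound: "\<And>y sa. norm (gradient (\<lambda>z. r z $ sa) y) \<le> C_rx"
    and grad_r_Lipschitz: "\<And>y1 y2 sa.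
          norm (gradient (\<lambda>z. r z $ sa) y1 - gradient (\<lambda>z. r z $ sa) y2) \<le> L_r * norm (y1 - y2)"
    and l_bound: "\<And>ds y. ds \<in> traj_tuples I H \<Longrightarrow> \<bar>l ds y\<bar> \<le> C_l"
    and l_C1: "\<And>ds. ds \<in> traj_tuples I H \<Longrightarrow> continuously_differentiable (l ds)"
    and l_Lipschitz: "\<And>ds y1 y2. ds \<in> traj_tuples I H \<Longrightarrow>
          \<bar>l ds y1 - l ds y2\<bar> \<le> L_l * norm (y1 - y2)"
    and grad_l_Lipschitz: "\<And>ds y1 y2. ds \<in> traj_tuples I H \<Longrightarrow>
          norm (gradient (l ds) y1 - gradient (l ds) y2) \<le> L_l1 * norm (y1 - y2)"
begin

abbreviation "grad_r x \<equiv> \<lambda>z. gradient (\<lambda>y. r y $ z) x"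

abbreviation "advantage x \<pi> s a \<equiv> grad_Q P \<gamma> r x \<pi> s a - grad_V P \<gamma> r x \<pi> s"

abbreviation "estimator \<equiv> grad_estimator P \<gamma> \<tau> r Pb \<rho>b I H l"

lemma ex_traj_tuple: obtains ds :: "('s \<times> 'a) list list" where "ds \<in> traj_tuples I H"
proof
  show "replicate I (replicate H undefined) \<in> traj_tuples I H" by (auto simp: traj_tuples_def)
qed

lemma C_rx_nonneg: "0 \<le> C_rx"
  by (rule order_trans[OF norm_ge_zero grad_r_bound])

lemma L_r_nonneg: "0 \<le> L_r"
  by (rule Lipschitz_const_nonneg[OF order_trans[OF norm_ge_zero grad_r_Lipschitz]])

lemma C_l_nonneg: "0 \<le> C_l"
proof -
  obtain ds :: "('s \<times> 'a) list list" where "ds \<in> traj_tuples I H" by (rule ex_traj_tuple)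
  from order_trans[OF abs_ge_zero l_bound[OF this]] show ?thesis .
qed

lemma L_l_nonneg: "0 \<le> L_l"
proof -
  obtain ds :: "('s \<times> 'a) list list" where "ds \<in> traj_tuples I H" by (rule ex_traj_tuple)
  from order_trans[OF abs_ge_zero l_Lipschitz[OF this]] show ?thesis
    by (rule Lipschitz_const_nonneg)
qed

lemma L_l1_nonneg: "0 \<le> L_l1"
proof -
  obtain ds :: "('s \<times> 'a) list list" where "ds \<in> traj_tuples I H" by (rule ex_traj_tuple)
  from order_trans[OF norm_ge_zero grad_l_Lipschitz[OF this]] show ?thesis
    by (rule Lipschitz_const_nonneg)
qed

lemma norm_grad_l_le:
  assumes ds: "ds \<in> traj_tuples I H"
  shows "norm (gradient (l ds) y) \<le> L_l"
  by (rule norm_GDERIV_le[OF L_l_nonneg GDERIV_gradient[OF l_C1[OF ds]] l_Lipschitz[OF ds]])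

lemma GDERIV_r: "GDERIV (\<lambda>y. r y $ z) x :> grad_r x z"
  by (rule GDERIV_gradient[OF r_C1])

lemma norm_advantage_le: "norm (advantage x \<pi> s a) \<le> 2 * C_rx / (1 - \<gamma>)"
proof -
  have "norm (grad_Q P \<gamma> r x \<pi> s a) \<le> C_rx / (1 - \<gamma>)"
    unfolding grad_Q_eq_Qval by (rule norm_Qval_le) (rule grad_r_bound)
  moreover have "norm (grad_V P \<gamma> r x \<pi> s) \<le> C_rx / (1 - \<gamma>)"
    unfolding grad_V_eq_Vval by (rule norm_Vval_le) (rule grad_r_bound)
  ultimately show ?thesis
    using norm_triangle_ineq4[of "grad_Q P \<gamma> r x \<pi> s a" "grad_V P \<gamma> r x \<pi> s"] by simp
qed

text \<open>The perturbation of \<open>Qval\<close> is that of \<open>Vval\<close> discounted once,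
  plus the change of the reward gradient. Adding the two gives the factor
  \<open>1 + \<gamma>\<close>.\<close>

lemma norm_advantage_diff_le:
  assumes \<delta>: "\<And>s. l1_dist (\<pi>\<^sub>1 s) (\<pi>\<^sub>2 s) \<le> \<delta>"
  shows "norm (advantage x\<^sub>1 \<pi>\<^sub>1 s a - advantage x\<^sub>2 \<pi>\<^sub>2 s a) \<le> L_r * norm (x\<^sub>1 - x\<^sub>2)
    + (1 + \<gamma>) * ((L_r * norm (x\<^sub>1 - x\<^sub>2) + \<delta> * C_rx / (1 - \<gamma>)) / (1 - \<gamma>))"
proof -
  define M where "M = (L_r * norm (x\<^sub>1 - x\<^sub>2) + \<delta> * C_rx / (1 - \<gamma>)) / (1 - \<gamma>)"
  have V: "norm (Vval \<pi>\<^sub>1 (grad_r x\<^sub>1) s - Vval \<pi>\<^sub>2 (grad_r x\<^sub>2) s) \<le> M" for s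
    unfolding M_def by (intro Vval_perturb grad_r_bound grad_r_Lipschitz \<delta>)
  have Q: "norm (Qval \<pi>\<^sub>1 (grad_r x\<^sub>1) s a - Qval \<pi>\<^sub>2 (grad_r x\<^sub>2) s a) \<le> L_r * norm (x\<^sub>1 - x\<^sub>2) + \<gamma> * M"
    by (intro Qval_diff_le V grad_r_Lipschitz)
  have "advantage x\<^sub>1 \<pi>\<^sub>1 s a - advantage x\<^sub>2 \<pi>\<^sub>2 s a
      = (Qval \<pi>\<^sub>1 (grad_r x\<^sub>1) s a - Qval \<pi>\<^sub>2 (grad_r x\<^sub>2) s a)
        - (Vval \<pi>\<^sub>1 (grad_r x\<^sub>1) s - Vval \<pi>\<^sub>2 (grad_r x\<^sub>2) s)"
    by (simp add: grad_Q_eq_Qval grad_V_eq_Vval)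
  also have "norm \<dots> \<le> (L_r * norm (x\<^sub>1 - x\<^sub>2) + \<gamma> * M) + M"
    by (rule order_trans[OF norm_triangle_ineq4 add_mono[OF Q V]])
  finally show ?thesis unfolding M_def[symmetric] by (simp add: algebra_simps)
qed

lemma estimator_diff_le:
  assumes \<delta>: "\<And>s. l1_dist (\<pi>\<^sub>1 s) (\<pi>\<^sub>2 s) \<le> \<delta>"
  shows "norm (estimator x\<^sub>1 \<pi>\<^sub>1 - estimator x\<^sub>2 \<pi>\<^sub>2)
    \<le> (real H * real I * \<delta> * L_l + L_l1 * norm (x\<^sub>1 - x\<^sub>2))
      + (1 / \<tau>) * (real H * real I * \<delta> * (C_l * (real H * real I * (2 * C_rx / (1 - \<gamma>))))
      + (L_l * norm (x\<^sub>1 - x\<^sub>2) * (real H * real I * (2 * C_rx / (1 - \<gamma>)))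
        + C_l * (real H * real I * (L_r * norm (x\<^sub>1 - x\<^sub>2)
          + (1 + \<gamma>) * ((L_r * norm (x\<^sub>1 - x\<^sub>2) + \<delta> * C_rx / (1 - \<gamma>)) / (1 - \<gamma>))))))"
proof -
  define p where "p \<pi> = replicate_pmf I (traj_pmf Pb \<rho>b H \<pi>)" for \<pi>
  define S where "S x \<pi> ds = (\<Sum>i<I. \<Sum>h<H. advantage x \<pi> (fst (ds ! i ! h)) (snd (ds ! i ! h)))"
    for x \<pi> and ds :: "('s \<times> 'a) list list"
  \<comment> \<open>\<open>B\<close> bounds the sum of advantages over a tuple and \<open>W\<close>
    its variation. The product with \<open>l\<close> then varies by at most
    \<open>L_l * norm (x\<^sub>1 - x\<^sub>2) * B + C_l * W\<close>, besides the change of the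
    law.\<close>
  define B where "B = real H * real I * (2 * C_rx / (1 - \<gamma>))"
  define W where "W = real H * real I * (L_r * norm (x\<^sub>1 - x\<^sub>2)
          + (1 + \<gamma>) * ((L_r * norm (x\<^sub>1 - x\<^sub>2) + \<delta> * C_rx / (1 - \<gamma>)) / (1 - \<gamma>)))"
  have S: "norm (S x \<pi> ds) \<le> B" for x \<pi> ds
    unfolding S_def B_def by (intro norm_double_sum_le norm_advantage_le)
  have S_diff: "norm (S x\<^sub>1 \<pi>\<^sub>1 ds - S x\<^sub>2 \<pi>\<^sub>2 ds) \<le> W" for ds
    unfolding S_def W_def sum_subtractf[symmetric]
    by (intro norm_double_sum_le norm_advantage_diff_le \<delta>)
  have B: "0 \<le> B" by (rule order_trans[OF norm_ge_zero S])
  have dist: "l1_dist (p \<pi>\<^sub>1) (p \<pi>\<^sub>2) \<le> real H * real I * \<delta>"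
    unfolding p_def by (rule l1_dist_tuple_le[OF H \<delta>])
  have fin: "finite (set_pmf (p \<pi>))" for \<pi>
    unfolding p_def by (rule finite_set_tuple_pmf[OF H])
  have sub: "ds \<in> traj_tuples I H" if "ds \<in> set_pmf (p \<pi>)" for ds \<pi>
    using that set_tuple_pmf[OF H] unfolding p_def by blast
  have "norm (measure_pmf.expectation (p \<pi>\<^sub>1) (\<lambda>ds. gradient (l ds) x\<^sub>1)
      - measure_pmf.expectation (p \<pi>\<^sub>2) (\<lambda>ds. gradient (l ds) x\<^sub>2))
      \<le> l1_dist (p \<pi>\<^sub>1) (p \<pi>\<^sub>2) * L_l + L_l1 * norm (x\<^sub>1 - x\<^sub>2)"
    by (intro norm_expectation_diff_le fin) (auto intro!: norm_grad_l_le grad_l_Lipschitz dest: sub)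
  also have "\<dots> \<le> real H * real I * \<delta> * L_l + L_l1 * norm (x\<^sub>1 - x\<^sub>2)"
    by (intro add_mono mult_right_mono dist L_l_nonneg) auto
  finally have 1: "norm (measure_pmf.expectation (p \<pi>\<^sub>1) (\<lambda>ds. gradient (l ds) x\<^sub>1)
      - measure_pmf.expectation (p \<pi>\<^sub>2) (\<lambda>ds. gradient (l ds) x\<^sub>2))
      \<le> real H * real I * \<delta> * L_l + L_l1 * norm (x\<^sub>1 - x\<^sub>2)" .
  have "norm (measure_pmf.expectation (p \<pi>\<^sub>1) (\<lambda>ds. l ds x\<^sub>1 *\<^sub>R S x\<^sub>1 \<pi>\<^sub>1 ds)
      - measure_pmf.expectation (p \<pi>\<^sub>2) (\<lambda>ds. l ds x\<^sub>2 *\<^sub>R S x\<^sub>2 \<pi>\<^sub>2 ds))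
      \<le> l1_dist (p \<pi>\<^sub>1) (p \<pi>\<^sub>2) * (C_l * B) + (L_l * norm (x\<^sub>1 - x\<^sub>2) * B + C_l * W)"
  proof (intro norm_expectation_diff_le fin)
    fix ds assume "ds \<in> set_pmf (p \<pi>\<^sub>1) \<union> set_pmf (p \<pi>\<^sub>2)"
    then have "ds \<in> traj_tuples I H" using sub by blast
    from l_bound[OF this, of x\<^sub>1] show "norm (l ds x\<^sub>1 *\<^sub>R S x\<^sub>1 \<pi>\<^sub>1 ds) \<le> C_l * B"
      using S C_l_nonneg by (auto intro!: mult_mono)
  next
    fix ds assume "ds \<in> set_pmf (p \<pi>\<^sub>2)"
    then have "ds \<in> traj_tuples I H" by (rule sub)
    then show "norm (l ds x\<^sub>1 *\<^sub>R S x\<^sub>1 \<pi>\<^sub>1 ds - l ds x\<^sub>2 *\<^sub>R S x\<^sub>2 \<pi>\<^sub>2 ds)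
        \<le> L_l * norm (x\<^sub>1 - x\<^sub>2) * B + C_l * W"
      by (intro norm_scaleR_diff_le l_Lipschitz l_bound S S_diff)
  qed
  also have "\<dots> \<le> real H * real I * \<delta> * (C_l * B) + (L_l * norm (x\<^sub>1 - x\<^sub>2) * B + C_l * W)"
    using mult_right_mono[OF dist, of "C_l * B"] B C_l_nonneg by simp
  finally have 2: "norm (measure_pmf.expectation (p \<pi>\<^sub>1) (\<lambda>ds. l ds x\<^sub>1 *\<^sub>R S x\<^sub>1 \<pi>\<^sub>1 ds)
      - measure_pmf.expectation (p \<pi>\<^sub>2) (\<lambda>ds. l ds x\<^sub>2 *\<^sub>R S x\<^sub>2 \<pi>\<^sub>2 ds))
      \<le> real H * real I * \<delta> * (C_l * B) + (L_l * norm (x\<^sub>1 - x\<^sub>2) * B + C_l * W)" .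
  have "estimator x\<^sub>1 \<pi>\<^sub>1 - estimator x\<^sub>2 \<pi>\<^sub>2
      = (measure_pmf.expectation (p \<pi>\<^sub>1) (\<lambda>ds. gradient (l ds) x\<^sub>1)
      - measure_pmf.expectation (p \<pi>\<^sub>2) (\<lambda>ds. gradient (l ds) x\<^sub>2))
      + (1 / \<tau>) *\<^sub>R (measure_pmf.expectation (p \<pi>\<^sub>1) (\<lambda>ds. l ds x\<^sub>1 *\<^sub>R S x\<^sub>1 \<pi>\<^sub>1 ds)
      - measure_pmf.expectation (p \<pi>\<^sub>2) (\<lambda>ds. l ds x\<^sub>2 *\<^sub>R S x\<^sub>2 \<pi>\<^sub>2 ds))"
    unfolding grad_estimator_def p_def S_def by (simp only: scaleR_diff_right) simp
  also have "norm \<dots> \<le> (real H * real I * \<delta> * L_l + L_l1 * norm (x\<^sub>1 - x\<^sub>2))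
      + (1 / \<tau>) * (real H * real I * \<delta> * (C_l * B) + (L_l * norm (x\<^sub>1 - x\<^sub>2) * B + C_l * W))"
  proof (rule norm_triangle_mono[OF 1])
    have "(1 / \<tau>) * norm v \<le> (1 / \<tau>) * z" if "norm v \<le> z" for v :: "real ^ 'n" and z
      using that tau by (intro mult_left_mono) auto
    from this[OF 2] show "norm ((1 / \<tau>) *\<^sub>R (measure_pmf.expectation (p \<pi>\<^sub>1) (\<lambda>ds. l ds x\<^sub>1 *\<^sub>R S x\<^sub>1 \<pi>\<^sub>1 ds)
      - measure_pmf.expectation (p \<pi>\<^sub>2) (\<lambda>ds. l ds x\<^sub>2 *\<^sub>R S x\<^sub>2 \<pi>\<^sub>2 ds)))
      \<le> (1 / \<tau>) * (real H * real I * \<delta> * (C_l * B) + (L_l * norm (x\<^sub>1 - x\<^sub>2) * B + C_l * W))"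
      using tau by simp
  qed
  finally show ?thesis unfolding B_def W_def .
qed

lemma hyper_objective_eq:
  "hyper_objective P \<gamma> \<tau> \<rho> r Pb \<rho>b I H l = (\<lambda>x. upper_objective Pb \<rho>b I H l x (opt_pi (r x)))"
  unfolding hyper_objective_def[abs_def] optimal_policy_eq_opt_pi[OF rho_pos] ..

lemma GDERIV_hyper_objective:
  "GDERIV (hyper_objective P \<gamma> \<tau> \<rho> r Pb \<rho>b I H l) x :> estimator x (opt_pi (r x))"
proof -
  let ?\<pi> = "opt_pi (r x)"
  have "GDERIV (\<lambda>y. pmf (opt_pi (r y) s) a) x :> pmf (?\<pi> s) a *\<^sub>R (1 / \<tau>) *\<^sub>R advantage x ?\<pi> s a" for s a
    using GDERIV_pmf_opt_pi[OF GDERIV_r, of s a x] by (simp add: grad_Q_eq_Qval grad_V_eq_Vval)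
  from GDERIV_upper_objective[OF H this GDERIV_gradient[OF l_C1]]
  have "GDERIV (\<lambda>y. upper_objective Pb \<rho>b I H l y (opt_pi (r y))) x :>
    (LINT ds|measure_pmf (replicate_pmf I (traj_pmf Pb \<rho>b H ?\<pi>)). gradient (l ds) x)
    + (LINT ds|measure_pmf (replicate_pmf I (traj_pmf Pb \<rho>b H ?\<pi>)). l ds x *\<^sub>R
      (\<Sum>i<I. \<Sum>h<H. (1 / \<tau>) *\<^sub>R advantage x ?\<pi> (fst (ds ! i ! h)) (snd (ds ! i ! h))))" .
  also have "(\<lambda>ds. l ds x *\<^sub>R
      (\<Sum>i<I. \<Sum>h<H. (1 / \<tau>) *\<^sub>R advantage x ?\<pi> (fst (ds ! i ! h)) (snd (ds ! i ! h))))
    = (\<lambda>ds. (1 / \<tau>) *\<^sub>R l ds x *\<^sub>R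
      (\<Sum>i<I. \<Sum>h<H. advantage x ?\<pi> (fst (ds ! i ! h)) (snd (ds ! i ! h))))"
    by (simp only: scaleR_sum_right[symmetric] scaleR_left_commute)
  finally show ?thesis
    unfolding hyper_objective_eq grad_estimator_def by (simp only: integral_scaleR_right)
qed

text \<open>Each entry has gradient equal to a probability times the advantage over
  \<open>\<tau>\<close>, of norm at most \<open>2 * C_rx / (\<tau> * (1 - \<gamma>))\<close>.
  Passing from the entries to the vector costs the root of their number.\<close>

lemma opt_pi_Lipschitz:
  "norm (policy_vec (opt_pi (r x\<^sub>1)) - policy_vec (opt_pi (r x\<^sub>2)))
    \<le> 2 * sqrt (CARD('s) * CARD('a)) * C_rx / (\<tau> * (1 - \<gamma>)) * norm (x\<^sub>1 - x\<^sub>2)"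
proof -
  define c where "c = 2 * C_rx / (\<tau> * (1 - \<gamma>))"
  have c0: "0 \<le> 2 * C_rx / (1 - \<gamma>) / \<tau>" using C_rx_nonneg gamma tau by simp
  have "\<bar>pmf (opt_pi (r x\<^sub>1) s) a - pmf (opt_pi (r x\<^sub>2) s) a\<bar> \<le> c * norm (x\<^sub>1 - x\<^sub>2)" for s a
  proof (rule GDERIV_Lipschitz[OF GDERIV_pmf_opt_pi[OF GDERIV_r]])
    fix x
    let ?\<pi> = "opt_pi (r x)"
    have "norm ((1 / \<tau>) *\<^sub>R (Qval ?\<pi> (grad_r x) s a - Vval ?\<pi> (grad_r x) s)) \<le> 2 * C_rx / (1 - \<gamma>) / \<tau>"
      using divide_right_mono[OF norm_advantage_le[of x ?\<pi> s a], of \<tau>] tau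
      by (simp add: grad_Q_eq_Qval grad_V_eq_Vval)
    then have "norm (pmf (?\<pi> s) a *\<^sub>R (1 / \<tau>) *\<^sub>R (Qval ?\<pi> (grad_r x) s a - Vval ?\<pi> (grad_r x) s))
        \<le> 1 * (2 * C_rx / (1 - \<gamma>) / \<tau>)"
      using c0 unfolding norm_scaleR[of "pmf _ _"] by (intro mult_mono) (auto simp: pmf_le_1)
    then show "norm (pmf (?\<pi> s) a *\<^sub>R (1 / \<tau>) *\<^sub>R (Qval ?\<pi> (grad_r x) s a - Vval ?\<pi> (grad_r x) s)) \<le> c"
      by (simp add: c_def mult.commute)
  qed
  then have "norm (policy_vec (opt_pi (r x\<^sub>1)) - policy_vec (opt_pi (r x\<^sub>2)))
      \<le> sqrt CARD('s \<times> 'a) * (c * norm (x\<^sub>1 - x\<^sub>2))"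
    by (intro norm_vec_le_sqrt_card) (auto simp: policy_vec_def)
  then show ?thesis by (simp add: c_def mult_ac)
qed

lemma estimator_policy_Lipschitz:
  "norm (estimator x \<pi>\<^sub>1 - estimator x \<pi>\<^sub>2)
    \<le> (H * I * L_l * sqrt CARD('a)
        + 2 * (1 / \<tau>) * C_l * C_rx * H * I * sqrt CARD('a) / (1 - \<gamma>) * ((1 + \<gamma>) / (1 - \<gamma>) + H * I))
      * norm (policy_vec \<pi>\<^sub>1 - policy_vec \<pi>\<^sub>2)"
proof -
  define k T where "k = 1 / (1 - \<gamma>)" and "T = 1 / \<tau>"
  have kT: "0 \<le> k" "0 \<le> T" using gamma tau by (simp_all add: k_def T_def)
  define \<delta> where "\<delta> = sqrt CARD('a) * norm (policy_vec \<pi>\<^sub>1 - policy_vec \<pi>\<^sub>2)"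
  have \<delta>0: "0 \<le> \<delta>" by (simp add: \<delta>_def)
  have div: "y / (1 - \<gamma>) = y * k" for y by (simp add: k_def)
  have "norm (estimator x \<pi>\<^sub>1 - estimator x \<pi>\<^sub>2)
      \<le> real H * real I * \<delta> * L_l + T * (real H * real I * \<delta> * (C_l * (real H * real I * (2 * C_rx * k)))
        + C_l * (real H * real I * ((1 + \<gamma>) * (\<delta> * C_rx * k * k))))"
    using estimator_diff_le[of \<pi>\<^sub>1 \<pi>\<^sub>2 \<delta> x x] l1_dist_le_policy_vec[of \<pi>\<^sub>1 _ \<pi>\<^sub>2]
    unfolding div T_def \<delta>_def by simp
  \<comment> \<open>A second copy of the term with \<open>1 + \<gamma>\<close> is added, because the
    prescribed constant carries it with a factor two.\<close>
  also have "\<dots> \<le> real H * real I * \<delta> * L_l + T * (real H * real I * \<delta> * (C_l * (real H * real I * (2 * C_rx * k)))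
        + C_l * (real H * real I * ((1 + \<gamma>) * (\<delta> * C_rx * k * k))))
        + T * C_l * real H * real I * (1 + \<gamma>) * \<delta> * C_rx * k * k"
    using kT \<delta>0 C_l_nonneg C_rx_nonneg gamma by simp
  also have "\<dots> = (H * I * L_l * sqrt CARD('a)
        + 2 * T * C_l * C_rx * H * I * sqrt CARD('a) * k * ((1 + \<gamma>) * k + H * I))
      * norm (policy_vec \<pi>\<^sub>1 - policy_vec \<pi>\<^sub>2)"
    unfolding \<delta>_def by (simp add: algebra_simps)
  finally show ?thesis unfolding div T_def .
qed

lemma hyper_gradient_Lipschitz:
  assumes L_\<pi>: "L_\<pi> = 2 * sqrt (CARD('s) * CARD('a)) * C_rx / (\<tau> * (1 - \<gamma>))"
    and L_V1: "L_V1 = (1 + \<gamma>) * C_rx * L_\<pi> * sqrt CARD('a) / (1 - \<gamma>)\<^sup>2 + L_r / (1 - \<gamma>)"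
    and L_\<phi>: "L_\<phi> = L_l1 + L_l * H * I * L_\<pi> * sqrt CARD('a)
          + 2 * (1 / \<tau>) * H * I * (C_l * L_V1 + C_rx / (1 - \<gamma>) * L_l)
          + 2 * (real H)\<^sup>2 * (real I)\<^sup>2 * C_l * C_rx * L_\<pi> / (\<tau> * (1 - \<gamma>)) * sqrt CARD('a)"
  shows "0 \<le> L_\<phi>"
    and "norm (estimator x\<^sub>1 (opt_pi (r x\<^sub>1)) - estimator x\<^sub>2 (opt_pi (r x\<^sub>2))) \<le> L_\<phi> * norm (x\<^sub>1 - x\<^sub>2)"
proof -
  define k T where "k = 1 / (1 - \<gamma>)" and "T = 1 / \<tau>"
  have kT: "0 \<le> k" "0 \<le> T" using gamma tau by (simp_all add: k_def T_def)
  have k1: "k = 1 + \<gamma> * k" using gamma by (simp add: k_def field_simps)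
  have div: "y / (1 - \<gamma>) = y * k" for y by (simp add: k_def)
  have L_\<pi>0: "0 \<le> L_\<pi>" unfolding L_\<pi> using gamma tau C_rx_nonneg by simp
  have L_V1': "L_V1 = (1 + \<gamma>) * C_rx * L_\<pi> * sqrt CARD('a) * k * k + L_r * k"
    unfolding L_V1 by (simp add: k_def power2_eq_square)
  have L_V10: "0 \<le> L_V1"
    unfolding L_V1' using gamma L_\<pi>0 C_rx_nonneg L_r_nonneg kT by simp
  have L_\<phi>': "L_\<phi> = L_l1 + L_l * H * I * L_\<pi> * sqrt CARD('a)
          + 2 * T * H * I * (C_l * L_V1 + C_rx * k * L_l)
          + 2 * H * H * I * I * C_l * C_rx * L_\<pi> * T * k * sqrt CARD('a)"
    unfolding L_\<phi> by (simp add: k_def T_def power2_eq_square)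
  show "0 \<le> L_\<phi>"
    unfolding L_\<phi>' using kT L_\<pi>0 L_V10 C_l_nonneg C_rx_nonneg L_l_nonneg L_l1_nonneg by simp
  define d where "d = norm (x\<^sub>1 - x\<^sub>2)"
  define \<delta> where "\<delta> = sqrt CARD('a) * (L_\<pi> * d)"
  have d0: "0 \<le> d" by (simp add: d_def)
  have "l1_dist (opt_pi (r x\<^sub>1) s) (opt_pi (r x\<^sub>2) s) \<le> \<delta>" for s
    using l1_dist_le_policy_vec[of "opt_pi (r x\<^sub>1)" s "opt_pi (r x\<^sub>2)"]
      mult_left_mono[OF opt_pi_Lipschitz[of x\<^sub>1 x\<^sub>2], of "sqrt CARD('a)"]
    unfolding \<delta>_def L_\<pi> d_def by simp
  from estimator_diff_le[of "opt_pi (r x\<^sub>1)" "opt_pi (r x\<^sub>2)" \<delta> x\<^sub>1 x\<^sub>2, OF this]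
  have "norm (estimator x\<^sub>1 (opt_pi (r x\<^sub>1)) - estimator x\<^sub>2 (opt_pi (r x\<^sub>2)))
    \<le> real H * real I * \<delta> * L_l + L_l1 * d
      + T * (real H * real I * \<delta> * (C_l * (real H * real I * (2 * C_rx * k)))
      + (L_l * d * (real H * real I * (2 * C_rx * k))
        + C_l * (real H * real I * (L_r * d + (1 + \<gamma>) * ((L_r * d + \<delta> * C_rx * k) * k)))))"
    unfolding div T_def[symmetric] d_def[symmetric] .
  \<comment> \<open>The identity \<open>k = 1 + \<gamma> * k\<close> absorbs the undiscounted reward
    term: \<open>Qval\<close> and \<open>Vval\<close> each contribute exactly
    \<open>L_r * d * k\<close>, which matches the part of \<open>2 * L_V1\<close> that contains
    \<open>L_r\<close>.\<close>
  also have "L_r * d + (1 + \<gamma>) * ((L_r * d + \<delta> * C_rx * k) * k)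
      = 2 * (L_r * d * k) + (1 + \<gamma>) * (\<delta> * C_rx * k * k)"
  proof -
    have "L_r * d + \<gamma> * (L_r * d * k) = L_r * d * (1 + \<gamma> * k)" by (simp add: algebra_simps)
    then have "L_r * d + \<gamma> * (L_r * d * k) = L_r * d * k" using k1 by simp
    moreover have "L_r * d + (1 + \<gamma>) * ((L_r * d + \<delta> * C_rx * k) * k)
        = (L_r * d + \<gamma> * (L_r * d * k)) + L_r * d * k + (1 + \<gamma>) * (\<delta> * C_rx * k * k)"
      by (simp add: algebra_simps)
    ultimately show ?thesis by simp
  qed
  \<comment> \<open>As for the policy bound, the policy part of the advantage term is doubled to
    reach \<open>2 * C_l * L_V1\<close>.\<close>
  also have "real H * real I * \<delta> * L_l + L_l1 * d
      + T * (real H * real I * \<delta> * (C_l * (real H * real I * (2 * C_rx * k)))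
      + (L_l * d * (real H * real I * (2 * C_rx * k))
        + C_l * (real H * real I * (2 * (L_r * d * k) + (1 + \<gamma>) * (\<delta> * C_rx * k * k)))))
    \<le> real H * real I * \<delta> * L_l + L_l1 * d
      + T * (real H * real I * \<delta> * (C_l * (real H * real I * (2 * C_rx * k)))
      + (L_l * d * (real H * real I * (2 * C_rx * k))
        + C_l * (real H * real I * (2 * (L_r * d * k) + (1 + \<gamma>) * (\<delta> * C_rx * k * k)))))
      + T * C_l * real H * real I * (1 + \<gamma>) * \<delta> * C_rx * k * k"
    using kT d0 L_\<pi>0 C_l_nonneg C_rx_nonneg gamma by (simp add: \<delta>_def)
  also have "\<dots> = L_\<phi> * d"
    unfolding \<delta>_def L_\<phi>' L_V1' by (simp add: algebra_simps)
  finally show "norm (estimator x\<^sub>1 (opt_pi (r x\<^sub>1)) - estimator x\<^sub>2 (opt_pi (r x\<^sub>2)))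
      \<le> L_\<phi> * norm (x\<^sub>1 - x\<^sub>2)" unfolding d_def .
qed

lemma hyper_objective_bounded: "\<bar>hyper_objective P \<gamma> \<tau> \<rho> r Pb \<rho>b I H l x\<bar> \<le> C_l"
proof -
  have "norm (hyper_objective P \<gamma> \<tau> \<rho> r Pb \<rho>b I H l x) \<le> C_l"
    unfolding hyper_objective_eq upper_objective_def
    by (intro norm_expectation_le finite_set_tuple_pmf[OF H])
       (auto intro!: l_bound subsetD[OF set_tuple_pmf[OF H]])
  then show ?thesis by simp
qed

end

theorem theorem7p6:
  fixes P Pb :: "'s::finite \<Rightarrow> 'a::finite \<Rightarrow> 's pmf"
    and \<rho> \<rho>b :: "'s pmf"
    and r :: "real ^ 'n \<Rightarrow> real ^ ('s \<times> 'a)"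
    and l :: "('s \<times> 'a) list list \<Rightarrow> real ^ 'n \<Rightarrow> real"
    and I H K :: nat
    and \<gamma> \<tau> \<epsilon> \<beta> C_r C_rx L_r C_l L_l L_l1 L_\<pi> L_V1 L_\<phi> L_\<phi>t \<phi>_star :: real
    and \<phi> :: "real ^ 'n \<Rightarrow> real"
    and x :: "nat \<Rightarrow> real ^ 'n"
    and \<pi> :: "nat \<Rightarrow> 's \<Rightarrow> 'a pmf"
  assumes gamma: "0 < \<gamma>" "\<gamma> < 1" and tau: "\<tau> > 0"
    and rho_pos: "\<And>s. pmf \<rho> s > 0"
    and I: "I \<ge> 1" and H: "H \<ge> 1" and K: "K \<ge> 1"
    and r_C1: "\<And>sa. continuously_differentiable (\<lambda>y. r y $ sa)"
    and r_bound: "\<And>y sa. \<bar>r y $ sa\<bar> \<le> C_r"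
    and grad_r_bound: "\<And>y sa. norm (gradient (\<lambda>z. r z $ sa) y) \<le> C_rx"
    and grad_r_Lipschitz: "\<And>y1 y2 sa.
          norm (gradient (\<lambda>z. r z $ sa) y1 - gradient (\<lambda>z. r z $ sa) y2) \<le> L_r * norm (y1 - y2)"
    and l_bound: "\<And>ds y. ds \<in> traj_tuples I H \<Longrightarrow> \<bar>l ds y\<bar> \<le> C_l"
    and l_C1: "\<And>ds. ds \<in> traj_tuples I H \<Longrightarrow> continuously_differentiable (l ds)"
    and l_Lipschitz: "\<And>ds y1 y2. ds \<in> traj_tuples I H \<Longrightarrow>
          \<bar>l ds y1 - l ds y2\<bar> \<le> L_l * norm (y1 - y2)"
    and grad_l_Lipschitz: "\<And>ds y1 y2. ds \<in> traj_tuples I H \<Longrightarrow>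
          norm (gradient (l ds) y1 - gradient (l ds) y2) \<le> L_l1 * norm (y1 - y2)"
    and L_pi: "L_\<pi> = 2 * sqrt (CARD('s) * CARD('a)) * C_rx / (\<tau> * (1 - \<gamma>))"
    and L_V1: "L_V1 = (1 + \<gamma>) * C_rx * L_\<pi> * sqrt CARD('a) / (1 - \<gamma>)\<^sup>2 + L_r / (1 - \<gamma>)"
    and L_phi: "L_\<phi> = L_l1 + L_l * H * I * L_\<pi> * sqrt CARD('a)
          + 2 * (1 / \<tau>) * H * I * (C_l * L_V1 + C_rx / (1 - \<gamma>) * L_l)
          + 2 * (real H)\<^sup>2 * (real I)\<^sup>2 * C_l * C_rx * L_\<pi> / (\<tau> * (1 - \<gamma>)) * sqrt CARD('a)"
    and L_phit: "L_\<phi>t = H * I * L_l * sqrt CARD('a)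
          + 2 * (1 / \<tau>) * C_l * C_rx * H * I * sqrt CARD('a) / (1 - \<gamma>)
            * ((1 + \<gamma>) / (1 - \<gamma>) + H * I)"
    and phi: "\<phi> = hyper_objective P \<gamma> \<tau> \<rho> r Pb \<rho>b I H l"
    and phi_star: "\<phi>_star = (INF y. \<phi> y)"
    \<comment> \<open>no restriction on \<open>\<beta>\<close> when \<open>L_\<phi> = 0\<close>, where \<open>1 / (2 * L_\<phi>)\<close> stands for infinity\<close>
    and beta: "\<beta> > 0" "L_\<phi> \<noteq> 0 \<Longrightarrow> \<beta> < 1 / (2 * L_\<phi>)"
    and algorithm: "SoBiRL P \<gamma> \<tau> \<rho> r Pb \<rho>b I H l \<epsilon> \<beta> K x \<pi>"
  shows "(1 / K) * (\<Sum>k=1..K. (norm (gradient \<phi> (x k)))\<^sup>2)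
       \<le> (\<phi> (x 1) - \<phi>_star) / (K * (\<beta> / 2 - \<beta>\<^sup>2 * L_\<phi>))
         + (1 + 2 * \<beta> * L_\<phi>) / (1 - 2 * \<beta> * L_\<phi>) * L_\<phi>t\<^sup>2 * \<epsilon>"
proof -
  interpret bilevel_mdp P \<gamma> \<tau> Pb \<rho> \<rho>b r l I H C_rx L_r C_l L_l L_l1
    by unfold_locales (fact gamma tau rho_pos H r_C1 grad_r_bound grad_r_Lipschitz
        l_bound l_C1 l_Lipschitz grad_l_Lipschitz)+
  define D where "D y = estimator y (opt_pi (r y))" for y
  have D: "GDERIV \<phi> y :> D y" for y
    unfolding phi D_def by (rule GDERIV_hyper_objective)
  then have gradient: "gradient \<phi> y = D y" for y by (rule gradient_eqI)
  have lip: "norm (D y - D z) \<le> L_\<phi> * norm (y - z)" for y z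
    unfolding D_def by (rule hyper_gradient_Lipschitz(2)[OF L_pi L_V1 L_phi])
  have L0: "0 \<le> L_\<phi>" by (rule hyper_gradient_Lipschitz(1)[OF L_pi L_V1 L_phi])
  have small: "2 * \<beta> * L_\<phi> < 1"
  proof (cases "L_\<phi> = 0")
    case False
    with L0 beta(2) show ?thesis by (simp add: field_simps)
  qed simp
  have step: "x (Suc k) = x k - \<beta> *\<^sub>R estimator (x k) (\<pi> k)" if "k \<in> {1..K}" for k
    using algorithm that by (simp add: SoBiRL_def)
  have err: "(norm (estimator (x k) (\<pi> k) - D (x k)))\<^sup>2 \<le> L_\<phi>t\<^sup>2 * \<epsilon>" if k: "k \<in> {1..K}" for k
  proof -
    let ?\<Delta> = "norm (policy_vec (\<pi> k) - policy_vec (opt_pi (r (x k))))"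
    have "(norm (estimator (x k) (\<pi> k) - D (x k)))\<^sup>2 \<le> (L_\<phi>t * ?\<Delta>)\<^sup>2"
      unfolding D_def L_phit by (intro power_mono estimator_policy_Lipschitz norm_ge_zero)
    also have "\<dots> \<le> L_\<phi>t\<^sup>2 * \<epsilon>"
      unfolding power_mult_distrib using algorithm k
      by (intro mult_left_mono) (auto simp: SoBiRL_def optimal_policy_eq_opt_pi[OF rho_pos])
    finally show ?thesis .
  qed
  \<comment> \<open>Boundedness of \<open>l\<close> by \<open>C_l\<close> carries over to its
    expectation, so the infimum is a genuine lower bound for the last iterate.\<close>
  have "bdd_below (range \<phi>)"
    unfolding phi using hyper_objective_bounded
    by (intro bdd_belowI2[where m="- C_l"]) (simp add: abs_le_iff minus_le_iff)
  then have lower: "\<phi>_star \<le> \<phi> y" for y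
    unfolding phi_star by (rule cINF_lower) simp
  show ?thesis
    unfolding gradient
    using inexact_descent_rate[where f=\<phi> and D=D and x=x and K=K
        and g="\<lambda>k. estimator (x k) (\<pi> k)", OF D lip L0 beta(1) small step err K lower] by (simp only: mult.assoc)
qed

end
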